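(* Let $n\ge 3$ and $N=\{1,2,\dots,n\}$. An $n\times n$ integer matrix $A=[a_{ij}]$ is the crossing matrix of a reducible pure $n$-braid if and only if $A$ is a zero-diagonal symmetric matrix and there exists a partition $N=N_1\amalg N_2\amalg\dots\amalg N_m$ of $N$ into $m$ nonempty subsets with $1<m<n$ such that for any distinct $k,l\in\{1,2,\dots,m\}$ and any $(i,j),(i',j')\in N_k\times N_l$, one has $a_{ij}=a_{i'j'}$.
   Context: $\mathcal{B}_n$ denotes the braid group on $n$ strands; an $n$-braid has $n$ strands running monotonically from an upper bar to a lower bar, and the product $bb'$ is $b$ placed above $b'$. The $i$-th strand is the one whose upper endpoint is in the $i$-th position from the left. A braid is pure if for every $i$ the $i$-th strand ends at the $i$-th position of the lower bar. In $\sigma_i$ the strands in positions $i$ and $i+1$ cross once, the strand going from position $i+1$ to position $i$ passing over; this crossing has sign $+1$. In $\sigma_i^{-1}$ the strand going from position $i$ to position $i+1$ passes over, and the crossing has sign $-1$. The crossing matrix $C(b)=[m_{ij}]$ of an $n$-braid $b$ is the $n\times n$ integer matrix with $m_{ii}=0$ and, for $i\ne j$, $m_{ij}$ equal to the sum of the signs of the crossings, in a diagram of $b$, at which the $i$-th strand is over the $j$-th strand. It does not depend on the diagram. Reducible is meant in the Nielsen–Thurston sense: regarding an $n$-braid as a mapping class of the $n$-punctured disk, it is reducible if it preserves, up to isotopy, a nonempty family of pairwise disjoint essential simple closed curves, where essential means enclosing at least $2$ and at most $n-1$ punctures. In particular, every periodic pure $n$-braid with $n\ge 3$ (including the trivial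 braid) is reducible. *)

theory Defs
  imports "HOL-Analysis.Analysis" "HOL-Combinatorics.Transposition" "HOL-Library.Disjoint_Sets"
begin

section \<open>The braid group\<close>

text \<open>
  A braid diagram in general position, read from top to bottom, is a word in the Artin generators:
  the letter \<open>(i, True)\<close> is \<open>\<sigma>\<^sub>i\<close> and \<open>(i, False)\<close> is its inverse. Strands and positions are numbered
  from \<open>1\<close>.
\<close>

type_synonym braid_word = "(nat \<times> bool) list"

definition braid_words :: "nat \<Rightarrow> braid_word set" where
  "braid_words n = lists ({1..<n} \<times> UNIV)"

inductive braid_move :: "nat \<Rightarrow> braid_word \<Rightarrow> braid_word \<Rightarrow> bool" for n where
  cancel:
    "\<lbrakk>u \<in> braid_words n; v \<in> braid_words n; i \<in> {1..<n}\<rbrakk>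
      \<Longrightarrow> braid_move n (u @ [(i, e), (i, \<not> e)] @ v) (u @ v)"
| far:
    "\<lbrakk>u \<in> braid_words n; v \<in> braid_words n; i \<in> {1..<n}; j \<in> {1..<n}; i + 2 \<le> j\<rbrakk>
      \<Longrightarrow> braid_move n (u @ [(i, True), (j, True)] @ v) (u @ [(j, True), (i, True)] @ v)"
| braid:
    "\<lbrakk>u \<in> braid_words n; v \<in> braid_words n; i \<in> {1..<n}; i + 1 \<in> {1..<n}\<rbrakk>
      \<Longrightarrow> braid_move n (u @ [(i, True), (i + 1, True), (i, True)] @ v)
                       (u @ [(i + 1, True), (i, True), (i + 1, True)] @ v)"

definition braid_rel :: "nat \<Rightarrow> (braid_word \<times> braid_word) set" where
  "braid_rel n = {(u, v). u \<in> braid_words n \<and> v \<in> braid_words n \<and> equivclp (braid_move n) u v}"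

definition braid_group :: "nat \<Rightarrow> braid_word set set" where
  "braid_group n = braid_words n // braid_rel n"

lemma equiv_braid_rel: "equiv (braid_words n) (braid_rel n)"
proof (rule equivI)
  show "braid_rel n \<subseteq> braid_words n \<times> braid_words n"
    by (auto simp: braid_rel_def)
  show "refl_on (braid_words n) (braid_rel n)"
    by (simp add: braid_rel_def refl_on_def)
  show "sym (braid_rel n)"
    by (auto simp: braid_rel_def intro!: symI intro: equivclp_sym)
  show "trans (braid_rel n)"
    by (auto simp: braid_rel_def intro!: transI intro: equivclp_trans)
qed


section \<open>Pure braids and the crossing matrix\<close>

text \<open>The lower end of the strand whose upper end is in position \<open>k\<close>.\<close>

fun end_position :: "braid_word \<Rightarrow> nat \<Rightarrow> nat" where
  "end_position [] k = k"
| "end_position ((i, e) # w) k = end_position w (Transposition.transpose i (i + 1) k)"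

text \<open>
  The sum of the signs of the crossings at which the strand starting in position \<open>k\<close> passes over the
  strand starting in position \<open>l\<close>. At \<open>\<sigma>\<^sub>i\<close> the strand coming from position \<open>i + 1\<close> is the upper one,
  at the inverse of \<open>\<sigma>\<^sub>i\<close> it is the strand coming from position \<open>i\<close>.
\<close>

fun word_crossing :: "braid_word \<Rightarrow> nat \<Rightarrow> nat \<Rightarrow> int" where
  "word_crossing [] k l = 0"
| "word_crossing ((i, e) # w) k l =
     (if e then of_bool (k = i + 1 \<and> l = i) else - of_bool (k = i \<and> l = i + 1))
     + word_crossing w (Transposition.transpose i (i + 1) k) (Transposition.transpose i (i + 1) l)"

lemma end_position_append: "end_position (u @ v) k = end_position v (end_position u k)"
  by (induction u k rule: end_position.induct) auto

lemma word_crossing_append: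
  "word_crossing (u @ v) k l
   = word_crossing u k l + word_crossing v (end_position u k) (end_position u l)"
  by (induction u k l rule: word_crossing.induct) auto

lemma braid_move_invariant:
  assumes "braid_move n u v"
  shows "end_position u k = end_position v k" "word_crossing u k l = word_crossing v k l"
proof -
  obtain u' v' x y where uv: "u = u' @ x @ v'" "v = u' @ y @ v'"
    and ends: "\<And>k. end_position x k = end_position y k"
    and crossings: "\<And>k l. word_crossing x k l = word_crossing y k l"
    using assms
  proof cases
    case (cancel u' v' i e)
    show ?thesis
    proof (rule that)
      show "u = u' @ [(i, e), (i, \<not> e)] @ v'" "v = u' @ [] @ v'"
        using cancel by simp_all
      show "end_position [(i, e), (i, \<not> e)] k = end_position [] k" for k
        by simp
      show "word_crossing [(i, e), (i, \<not> e)] k l = word_crossing [] k l" for k l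
        by (cases e) (simp_all add: Transposition.transpose_def)
    qed
  next
    case (far u' v' i j)
    show ?thesis
    proof (rule that[OF far(1,2)])
      show "end_position [(i, True), (j, True)] k = end_position [(j, True), (i, True)] k" for k
        using far by (simp add: Transposition.transpose_def)
      show "word_crossing [(i, True), (j, True)] k l = word_crossing [(j, True), (i, True)] k l"
        for k l
        using far by (simp add: Transposition.transpose_def)
    qed
  next
    case (braid u' v' i)
    show ?thesis
    proof (rule that[OF braid(1,2)])
      show "end_position [(i, True), (i + 1, True), (i, True)] k
          = end_position [(i + 1, True), (i, True), (i + 1, True)] k" for k
        by (simp add: Transposition.transpose_def)
      show "word_crossing [(i, True), (i + 1, True), (i, True)] k l
          = word_crossing [(i + 1, True), (i, True), (i + 1, True)] k l" for k l
        by (simp add: Transposition.transpose_def)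
    qed
  qed
  show "end_position u k = end_position v k"
    by (simp add: uv end_position_append ends)
  show "word_crossing u k l = word_crossing v k l"
    by (simp add: uv end_position_append word_crossing_append ends crossings)
qed

lemma braid_rel_end_position:
  assumes "(u, v) \<in> braid_rel n"
  shows "end_position u k = end_position v k"
proof -
  have "equivclp (braid_move n) u v"
    using assms by (simp add: braid_rel_def)
  then show ?thesis
  proof (induction rule: equivclp_induct)
    case (step v w)
    then show ?case
      using braid_move_invariant(1)[of n v w] braid_move_invariant(1)[of n w v] by metis
  qed simp
qed

lemma braid_rel_word_crossing:
  assumes "(u, v) \<in> braid_rel n"
  shows "word_crossing u k l = word_crossing v k l"
proof -
  have "equivclp (braid_move n) u v"
    using assms by (simp add: braid_rel_def)
  then show ?thesis
  proof (induction rule: equivclp_induct)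
    case (step v w)
    then show ?case
      using braid_move_invariant(2)[of n v w] braid_move_invariant(2)[of n w v] by metis
  qed simp
qed

definition pure_braid :: "nat \<Rightarrow> braid_word set \<Rightarrow> bool" where
  "pure_braid n b \<longleftrightarrow> (\<forall>w\<in>b. \<forall>k\<in>{1..n}. end_position w k = k)"

definition crossing_matrix :: "braid_word set \<Rightarrow> nat \<Rightarrow> nat \<Rightarrow> int" where
  "crossing_matrix b k l = the_elem ((\<lambda>w. word_crossing w k l) ` b)"

lemma crossing_matrix_eq:
  assumes "b \<in> braid_group n" "w \<in> b"
  shows "crossing_matrix b k l = word_crossing w k l"
proof -
  have "word_crossing v k l = word_crossing w k l" if "v \<in> b" for v
  proof -
    have "b \<in> braid_words n // braid_rel n"
      using assms(1) by (simp only: braid_group_def)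
    then have "(v, w) \<in> braid_rel n"
      using quotient_eq_iff[OF equiv_braid_rel _ _ that assms(2)] by blast
    then show ?thesis
      by (rule braid_rel_word_crossing)
  qed
  then have "(\<lambda>w. word_crossing w k l) ` b = {word_crossing w k l}"
    using assms(2) by blast
  then show ?thesis
    by (simp add: crossing_matrix_def)
qed


section \<open>Braids as mapping classes of the punctured disk\<close>

text \<open>
  The disk has the segment from \<open>0\<close> to \<open>n + 1\<close> as a diameter, and the punctures are \<open>1, \<dots>, n\<close>. A
  self-homeomorphism of the punctured disk is given as a homeomorphism of the full disk that
  preserves the set of punctures.
\<close>

definition disk :: "nat \<Rightarrow> complex set" where
  "disk n = cball (of_real ((real n + 1) / 2)) ((real n + 1) / 2)"

definition punctures :: "nat \<Rightarrow> complex set" where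
  "punctures n = of_nat ` {1..n}"

definition disk_homeo :: "nat \<Rightarrow> (complex \<Rightarrow> complex) \<Rightarrow> bool" where
  "disk_homeo n f \<longleftrightarrow>
     (\<exists>g. homeomorphism (disk n) (disk n) f g) \<and> f ` punctures n = punctures n \<and>
     (\<forall>z\<in>frontier (disk n). f z = z)"

text \<open>
  The half twist exchanging the punctures \<open>i\<close> and \<open>i + 1\<close>, supported in the closed disk of radius
  \<open>1\<close> about their midpoint. A braid is drawn with the positive imaginary axis of each horizontal
  slice pointing away from the viewer; as the strand moving left in \<open>\<sigma>\<^sub>i\<close> is in front, the
  punctures turn clockwise when the braid is traversed downwards.
\<close>

definition half_twist :: "nat \<times> bool \<Rightarrow> complex \<Rightarrow> complex" where
  "half_twist = (\<lambda>(i, e) z.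
     let c = of_real (real i + 1 / 2); r = cmod (z - c)
     in c + (z - c) * cis ((if e then - 1 else 1) * pi * max 0 (min 1 (2 - 2 * r))))"

text \<open>
  The upper letters act first, so that the homeomorphism takes the puncture \<open>k\<close> to the lower end of
  the \<open>k\<close>-th strand.
\<close>

fun word_homeo :: "braid_word \<Rightarrow> complex \<Rightarrow> complex" where
  "word_homeo [] = id"
| "word_homeo (x # w) = word_homeo w \<circ> half_twist x"

text \<open>
  Isotopies fix the boundary pointwise and preserve the set of punctures at all times, so the image
  of each puncture stays constant by continuity. All words of a braid give the same isotopy class,
  since the half twists satisfy the braid relations up to isotopy.
\<close>

definition mapping_class :: "nat \<Rightarrow> braid_word set \<Rightarrow> (complex \<Rightarrow> complex) set" where
  "mapping_class n b =
     {g. \<exists>w\<in>b. homotopic_with_canon (disk_homeo n) (disk n) (disk n) (word_homeo w) g}"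


section \<open>Reducible braids\<close>

definition essential_curve :: "nat \<Rightarrow> complex set \<Rightarrow> bool" where
  "essential_curve n C \<longleftrightarrow>
     (\<exists>\<gamma>. simple_path \<gamma> \<and> pathfinish \<gamma> = pathstart \<gamma> \<and> path_image \<gamma> = C) \<and>
     C \<subseteq> disk n - punctures n \<and>
     card (inside C \<inter> punctures n) \<in> {2..n - 1}"

text \<open>A family of curves is preserved up to isotopy if some member of the mapping class permutes it.\<close>

definition reducible_braid :: "nat \<Rightarrow> braid_word set \<Rightarrow> bool" where
  "reducible_braid n b \<longleftrightarrow>
     (\<exists>\<C>. \<C> \<noteq> {} \<and> finite \<C> \<and> (\<forall>C\<in>\<C>. essential_curve n C) \<and> pairwise disjnt \<C> \<and>
       (\<exists>g\<in>mapping_class n b. (\<lambda>C. g ` C) ` \<C> = \<C>))"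

end

theory Submission
  imports Defs "HOL-Complex_Analysis.Riemann_Mapping"
begin

text \<open>
  Let \<open>C\<close> be a curve enclosing the set \<open>S\<close> of punctures. The two directions rest on the same
  observation: a braid that preserves \<open>C\<close> treats the strands in \<open>S\<close> as one fat strand, so a strand
  outside \<open>S\<close> winds equally often round every strand in \<open>S\<close>. On the matrix side, a partition with
  constant off-diagonal blocks matters only through one block \<open>S\<close> with \<open>2 \<le> card S < n\<close>: the
  partition into \<open>S\<close> and singletons has constant blocks as soon as the rows outside \<open>S\<close> are constant
  on \<open>S\<close>. So the claim is that \<open>A\<close> comes from a reducible pure braid iff \<open>A\<close> is symmetric with zero
  diagonal and there is such a set \<open>S\<close> (\<open>singleton_blocks_partition\<close>, \<open>partition_large_block\<close>).

  \<^emph>\<open>From the braid to the matrix.\<close> Symmetry is combinatorial: each crossing of two strands changes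
  \<open>m_kl - m_lk\<close> by one and reverses their order, so the difference depends only on the initial and
  the final order (\<open>word_crossing_swap\<close>). For the rows, fix a strand \<open>i\<close> outside \<open>C\<close>. While the disk
  is deformed from the identity to a homeomorphism \<open>f\<close> of the mapping class, the vector from the
  moving point \<open>i\<close> to the moving point \<open>z\<close> turns by an angle that depends continuously on \<open>z\<close>.
  It is the imaginary part of a continuous logarithm \<open>L\<close> of \<open>(f z - i) / (z - i)\<close>, and at a puncture
  \<open>j\<close> it is \<open>- 2 \<pi> m_ij\<close> (\<open>word_angle_lift\<close>, preserved by isotopies in \<open>isotopic_angle_lift\<close>). Some
  power \<open>g ^^ k\<close> of the given homeomorphism maps a curve \<open>C\<close> of the family onto itself, hence its
  inside onto itself. The inside is simply connected and misses \<open>i\<close>, so \<open>z - i\<close> has a logarithm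
  \<open>\<alpha>\<close> there, and the sum of \<open>L\<close> along the orbit of \<open>z\<close> differs from \<open>\<alpha> (g ^^ k z) - \<alpha> z\<close> by a
  constant. At a puncture \<open>j\<close> inside \<open>C\<close> this constant is \<open>k * L j\<close>, which is therefore independent of
  \<open>j\<close> (\<open>invariant_curve_crossing\<close>).

  \<^emph>\<open>From the matrix to the braid.\<close> Conjugation by generators permutes the matrix and moves the curve
  along, so \<open>S\<close> may be taken to be \<open>{1..s}\<close> with a round curve (\<open>realized_block\<close>). The matrix is then
  an integer combination of matrices with a single symmetric pair of ones in two positions on the same
  side of the curve, realized by words in generators that fix the curve, and of matrices of loops of
  one strand round the whole block \<open>{1..s}\<close>. The word for such a loop preserves the curve only up to
  isotopy. This is the main difficulty, settled by \<open>loop_around_isotopic\<close>: the loop can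
  also be performed by an explicit motion that carries the block along by a parallel translation, with
  an end map that is the identity on the curve. At every time the punctures in the two motions can be
  joined by straight lines without collisions, and motions related in this way have isotopic end maps
  (\<open>isotopic_if_motions_apart\<close>).
\<close>

section \<open>Twists of the plane\<close>

text \<open>
  Rigid rotation by the angle \<open>\<theta>\<close> on the disk of radius \<open>R - 1 / 2\<close> about \<open>c\<close>, fading out to the
  identity on the circle of radius \<open>R\<close>. The half twists are the case \<open>R = 1\<close>, \<open>\<theta> = \<plusminus>\<pi>\<close>.
\<close>

definition twist :: "complex \<Rightarrow> real \<Rightarrow> real \<Rightarrow> complex \<Rightarrow> complex" where
  "twist c R \<theta> z = c + (z - c) * cis (\<theta> * max 0 (min 1 (2 * R - 2 * cmod (z - c))))"

lemma cmod_twist: "cmod (twist c R \<theta> z - c) = cmod (z - c)"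
  by (simp add: twist_def norm_mult)

lemma twist_twist: "twist c R \<theta> (twist c R \<phi> z) = twist c R (\<theta> + \<phi>) z"
proof -
  have "twist c R \<theta> (twist c R \<phi> z)
      = c + (twist c R \<phi> z - c) * cis (\<theta> * max 0 (min 1 (2 * R - 2 * cmod (z - c))))"
    by (subst twist_def, subst cmod_twist) simp
  then show ?thesis
    by (simp add: twist_def mult.assoc cis_mult algebra_simps)
qed

lemma twist_0 [simp]: "twist c R 0 z = z"
  by (simp add: twist_def)

lemma twist_outside: "R \<le> cmod (z - c) \<Longrightarrow> twist c R \<theta> z = z"
  by (simp add: twist_def)

lemma twist_inside: "cmod (z - c) \<le> R - 1 / 2 \<Longrightarrow> twist c R \<theta> z = c + (z - c) * cis \<theta>"
  by (simp add: twist_def max_def min_def)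

lemma continuous_on_twist [continuous_intros]:
  assumes "continuous_on S f" "continuous_on S g"
  shows "continuous_on S (\<lambda>x. twist c R (f x) (g x))"
  unfolding twist_def using assms by (intro continuous_intros)


section \<open>Homeomorphisms and isotopies of the disk\<close>

text \<open>
  Homeomorphisms of the disk that fix its boundary, without any condition on the punctures: the stages
  of a motion of the punctures are of this kind.
\<close>

definition disk_auto :: "nat \<Rightarrow> (complex \<Rightarrow> complex) \<Rightarrow> bool" where
  "disk_auto n f \<longleftrightarrow> continuous_on (disk n) f \<and> bij_betw f (disk n) (disk n) \<and>
     (\<forall>z\<in>frontier (disk n). f z = z)"

lemma compact_disk: "compact (disk n)" and convex_disk: "convex (disk n)"
  by (simp_all add: disk_def)

lemma frontier_disk_subset: "frontier (disk n) \<subseteq> disk n"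
  by (simp add: frontier_subset_closed disk_def)

lemma interior_Un_frontier_disk: "disk n = interior (disk n) \<union> frontier (disk n)"
  using interior_subset[of "disk n"] compact_imp_closed[OF compact_disk, of n]
  by (auto simp: frontier_def closure_closed)

lemma punctures_subset_interior: "punctures n \<subseteq> interior (disk n)"
proof
  fix z assume "z \<in> punctures n"
  then obtain k where k: "z = of_nat k" "1 \<le> k" "k \<le> n" by (auto simp: punctures_def)
  have "dist (complex_of_real ((real n + 1) / 2)) (of_nat k) = \<bar>(real n + 1) / 2 - real k\<bar>"
    by (metis dist_of_real dist_real_def of_real_of_nat_eq)
  also have "\<dots> < (real n + 1) / 2"
    using k by (simp add: abs_less_iff field_simps)
  finally show "z \<in> interior (disk n)"
    by (simp add: disk_def k)
qed

lemma punctures_subset: "punctures n \<subseteq> disk n"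
  using punctures_subset_interior interior_subset by blast

lemma disk_homeo_iff: "disk_homeo n f \<longleftrightarrow> disk_auto n f \<and> f ` punctures n = punctures n"
proof
  assume "disk_homeo n f"
  then show "disk_auto n f \<and> f ` punctures n = punctures n"
    unfolding disk_homeo_def disk_auto_def homeomorphism_def bij_betw_def
    by (metis inj_on_inverseI)
next
  assume "disk_auto n f \<and> f ` punctures n = punctures n"
  then show "disk_homeo n f"
    unfolding disk_homeo_def disk_auto_def bij_betw_def
    by (metis homeomorphism_compact compact_disk)
qed

lemma disk_auto_cong:
  assumes "\<And>z. z \<in> disk n \<Longrightarrow> f z = g z"
  shows "disk_auto n f \<longleftrightarrow> disk_auto n g"
  using assms frontier_disk_subset unfolding disk_auto_def
  by (metis (no_types, lifting) bij_betw_cong continuous_on_cong subsetD)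

lemma disk_homeo_cong:
  assumes "\<And>z. z \<in> disk n \<Longrightarrow> f z = g z"
  shows "disk_homeo n f \<longleftrightarrow> disk_homeo n g"
proof -
  have "f ` punctures n = g ` punctures n"
    using assms punctures_subset by (intro image_cong) auto
  with disk_auto_cong[of n f g] assms show ?thesis
    by (simp add: disk_homeo_iff)
qed

lemma disk_auto_compose:
  assumes "disk_auto n f" "disk_auto n g"
  shows "disk_auto n (\<lambda>z. g (f z))"
proof -
  have "continuous_on (disk n) (\<lambda>z. g (f z))"
    using assms unfolding disk_auto_def bij_betw_def
    by (metis continuous_on_compose2 order_refl)
  moreover have "bij_betw (\<lambda>z. g (f z)) (disk n) (disk n)"
    using assms bij_betw_trans unfolding disk_auto_def comp_def by blast
  ultimately show ?thesis
    using assms by (auto simp: disk_auto_def)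
qed

lemma disk_homeo_compose:
  assumes "disk_homeo n f" "disk_homeo n g"
  shows "disk_homeo n (\<lambda>z. g (f z))"
  using assms disk_auto_compose[of n f g] unfolding disk_homeo_iff
  by (metis image_image)

lemma disk_auto_in_disk: "disk_auto n f \<Longrightarrow> z \<in> disk n \<Longrightarrow> f z \<in> disk n"
  by (auto simp: disk_auto_def bij_betw_def)

lemma disk_auto_inj:
  "disk_auto n f \<Longrightarrow> z \<in> disk n \<Longrightarrow> w \<in> disk n \<Longrightarrow> f z = f w \<longleftrightarrow> z = w"
  by (auto simp: disk_auto_def bij_betw_def inj_on_def)

lemma disk_auto_interior:
  assumes f: "disk_auto n f" and z: "z \<in> interior (disk n)"
  shows "f z \<in> interior (disk n)"
proof (rule ccontr)
  have z': "z \<in> disk n" using z interior_subset by blast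
  assume "f z \<notin> interior (disk n)"
  then have fr: "f z \<in> frontier (disk n)"
    using disk_auto_in_disk[OF f z'] interior_Un_frontier_disk by blast
  then have "f (f z) = f z" using f by (auto simp: disk_auto_def)
  then have "f z = z" using disk_auto_inj[OF f disk_auto_in_disk[OF f z'] z'] by simp
  then show False using fr z by (simp add: frontier_def)
qed

lemma disk_auto_id: "disk_auto n (\<lambda>z. z)"
  by (auto simp: disk_auto_def bij_betw_def)

lemma disk_auto_twist:
  assumes "cball c R \<subseteq> disk n"
  shows "disk_auto n (twist c R \<theta>)"
  unfolding disk_auto_def
proof (intro conjI ballI)
  show "continuous_on (disk n) (twist c R \<theta>)"
    by (intro continuous_intros)
  have mapsto: "twist c R \<phi> z \<in> disk n" if "z \<in> disk n" for z \<phi>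
  proof (cases "R \<le> cmod (z - c)")
    case True
    with that show ?thesis by (simp add: twist_outside)
  next
    case False
    then have "twist c R \<phi> z \<in> cball c R"
      using cmod_twist[of c R \<phi> z] by (simp add: dist_norm norm_minus_commute)
    with assms show ?thesis by blast
  qed
  show "bij_betw (twist c R \<theta>) (disk n) (disk n)"
    by (rule bij_betw_byWitness[where f' = "twist c R (- \<theta>)"])
      (auto simp: twist_twist mapsto)
  show "twist c R \<theta> z = z" if "z \<in> frontier (disk n)" for z
  proof (rule twist_outside)
    have "ball c R \<subseteq> interior (disk n)"
      using assms by (meson ball_subset_cball interior_maximal open_ball order_trans)
    with that have "z \<notin> ball c R" by (auto simp: frontier_def)
    then show "R \<le> cmod (z - c)" by (simp add: dist_norm norm_minus_commute)
  qed
qed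

lemma cball_subset_disk:
  assumes "c = of_real x" "R \<le> x" "x + R \<le> real n + 1"
  shows "cball c R \<subseteq> disk n"
proof -
  have "dist (complex_of_real x) (complex_of_real ((real n + 1) / 2)) = \<bar>x - (real n + 1) / 2\<bar>"
    by (simp only: dist_of_real dist_real_def)
  also have "\<dots> + R \<le> (real n + 1) / 2"
    using assms by (auto simp: abs_if field_simps)
  finally show ?thesis
    unfolding disk_def assms(1)
    by (subst cball_subset_cball_iff) auto
qed

abbreviation isotopic :: "nat \<Rightarrow> (complex \<Rightarrow> complex) \<Rightarrow> (complex \<Rightarrow> complex) \<Rightarrow> bool" where
  "isotopic n \<equiv> homotopic_with_canon (disk_homeo n) (disk n) (disk n)"

lemma isotopicI:
  fixes F :: "real \<Rightarrow> complex \<Rightarrow> complex"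
  assumes T: "0 < T"
    and cont: "continuous_on ({0..T} \<times> disk n) (\<lambda>(t, z). F t z)"
    and homeo: "\<And>t. t \<in> {0..T} \<Longrightarrow> disk_homeo n (F t)"
    and ends: "\<And>z. z \<in> disk n \<Longrightarrow> F 0 z = f z" "\<And>z. z \<in> disk n \<Longrightarrow> F T z = g z"
  shows "isotopic n f g"
proof (subst homotopic_with)
  show "disk_homeo n h = disk_homeo n k"
    if "\<And>x. x \<in> topspace (top_of_set (disk n)) \<Longrightarrow> h x = k x" for h k
    using that disk_homeo_cong[of n h k] by simp
  have scale: "T * t \<in> {0..T}" if "t \<in> {0..1}" for t
    using that T by (auto simp: mult_le_cancel_left1 mult_left_le)
  have "continuous_on ({0..1} \<times> disk n) ((\<lambda>(t, z). F t z) \<circ> (\<lambda>(t, z). (T * t, z)))"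
  proof (rule continuous_on_compose)
    show "continuous_on ({0..1} \<times> disk n) (\<lambda>(t, z). (T * t, z))"
      by (auto simp: case_prod_beta intro!: continuous_intros)
    show "continuous_on ((\<lambda>(t, z). (T * t, z)) ` ({0..1} \<times> disk n)) (\<lambda>(t, z). F t z)"
      by (rule continuous_on_subset[OF cont]) (use scale in force)
  qed
  moreover have "F (T * t) z \<in> disk n" if "t \<in> {0..1}" "z \<in> disk n" for t z
    using homeo[OF scale[OF that(1)]] that(2) by (auto simp: disk_homeo_iff intro: disk_auto_in_disk)
  ultimately have cm: "continuous_map (prod_topology (top_of_set {0..1}) (top_of_set (disk n)))
      (top_of_set (disk n)) (\<lambda>(t, z). F (T * t) z)"
    by (auto simp: comp_def case_prod_beta simp flip: subtopology_Times)
  show "\<exists>h. continuous_map (prod_topology (top_of_set {0..1::real}) (top_of_set (disk n)))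
             (top_of_set (disk n)) h \<and>
          (\<forall>x\<in>topspace (top_of_set (disk n)). h (0, x) = f x) \<and>
          (\<forall>x\<in>topspace (top_of_set (disk n)). h (1, x) = g x) \<and>
          (\<forall>t\<in>{0..1}. disk_homeo n (\<lambda>x. h (t, x)))"
    by (rule exI[of _ "\<lambda>(t, z). F (T * t) z"]) (intro conjI, rule cm, auto simp: ends homeo[OF scale])
qed

lemma isotopicE:
  assumes "isotopic n f g"
  obtains F where "continuous_on ({0..1::real} \<times> disk n) (\<lambda>(t, z). F t z)"
    "\<And>t. t \<in> {0..1} \<Longrightarrow> disk_homeo n (F t)" "F 0 = f" "F 1 = g"
proof -
  from assms obtain h where "continuous_on ({0..1} \<times> disk n) h" "h \<in> {0..1} \<times> disk n \<rightarrow> disk n"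
    "\<forall>x. h (0, x) = f x" "\<forall>x. h (1, x) = g x" "\<forall>t\<in>{0..1::real}. disk_homeo n (\<lambda>x. h (t, x))"
    by (auto simp: homotopic_with_def simp flip: subtopology_Times)
  then show ?thesis
    by (intro that[of "\<lambda>t z. h (t, z)"]) (auto simp: fun_eq_iff)
qed

lemma isotopic_imp_disk_homeo:
  assumes "isotopic n f g"
  shows "disk_homeo n f" "disk_homeo n g"
  using homotopic_with_imp_property[OF assms] by auto

lemma isotopic_refl: "disk_homeo n f \<Longrightarrow> isotopic n f f"
  using disk_auto_in_disk by (auto simp: homotopic_with_refl disk_homeo_iff disk_auto_def)

lemma isotopic_compose:
  assumes "isotopic n f f'" "isotopic n g g'"
  shows "isotopic n (\<lambda>z. g (f z)) (\<lambda>z. g' (f' z))"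
proof -
  obtain F where F: "continuous_on ({0..1::real} \<times> disk n) (\<lambda>(t, z). F t z)"
    "\<And>t. t \<in> {0..1} \<Longrightarrow> disk_homeo n (F t)" "F 0 = f" "F 1 = f'"
    using isotopicE[OF assms(1)] by blast
  obtain G where G: "continuous_on ({0..1::real} \<times> disk n) (\<lambda>(t, z). G t z)"
    "\<And>t. t \<in> {0..1} \<Longrightarrow> disk_homeo n (G t)" "G 0 = g" "G 1 = g'"
    using isotopicE[OF assms(2)] by blast
  show ?thesis
  proof (rule isotopicI[of 1 n "\<lambda>t z. G t (F t z)"])
    have "continuous_on ({0..1} \<times> disk n) (\<lambda>p. (\<lambda>(t, z). G t z) (fst p, F (fst p) (snd p)))"
    proof (rule continuous_on_compose2[OF G(1)])
      show "continuous_on ({0..1} \<times> disk n) (\<lambda>p. (fst p, F (fst p) (snd p)))"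
        using F(1) by (auto simp: case_prod_beta intro!: continuous_intros)
      show "(\<lambda>p. (fst p, F (fst p) (snd p))) ` ({0..1} \<times> disk n) \<subseteq> {0..1} \<times> disk n"
        using F(2) by (auto simp: disk_homeo_iff intro: disk_auto_in_disk)
    qed
    then show "continuous_on ({0..1} \<times> disk n) (\<lambda>(t, z). G t (F t z))"
      by (simp add: case_prod_beta)
  qed (use F G in \<open>auto intro: disk_homeo_compose\<close>)
qed


section \<open>The motion of the disk given by a braid word\<close>

text \<open>
  The twist of a letter, performed during the time interval from \<open>0\<close> to \<open>1\<close>. Time is clamped to this
  interval, so that concatenated motions need no case distinction on the time.
\<close>

definition letter_motion :: "nat \<times> bool \<Rightarrow> real \<Rightarrow> complex \<Rightarrow> complex" where
  "letter_motion x t =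
     twist (of_real (real (fst x) + 1 / 2)) 1 ((if snd x then - pi else pi) * max 0 (min 1 t))"

text \<open>
  The \<open>l\<close>-th letter, counted from \<open>0\<close>, acts between the times \<open>l\<close> and \<open>l + 1\<close>: the later letters
  stay at rest before that because of the clamping.
\<close>

fun word_motion :: "braid_word \<Rightarrow> real \<Rightarrow> complex \<Rightarrow> complex" where
  "word_motion [] t z = z"
| "word_motion (x # w) t z = word_motion w (t - 1) (letter_motion x t z)"

lemma half_twist_eq: "half_twist x = letter_motion x 1"
  by (cases x) (auto simp: half_twist_def letter_motion_def twist_def fun_eq_iff Let_def)

lemma letter_motion_start: "t \<le> 0 \<Longrightarrow> letter_motion x t z = z"
  by (simp add: letter_motion_def max_def min_def)

lemma letter_motion_end: "1 \<le> t \<Longrightarrow> letter_motion x t z = half_twist x z"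
  by (simp add: letter_motion_def max_def min_def half_twist_eq)

lemma word_motion_start: "t \<le> 0 \<Longrightarrow> word_motion w t z = z"
  by (induction w arbitrary: t z) (auto simp: letter_motion_start)

lemma word_motion_end: "real (length w) \<le> t \<Longrightarrow> word_motion w t z = word_homeo w z"
  by (induction w arbitrary: t z) (auto simp: letter_motion_end)

lemma word_motion_append:
  "word_motion (u @ v) t z = word_motion v (t - length u) (word_motion u t z)"
  by (induction u arbitrary: t z) (auto simp: algebra_simps)

lemma word_homeo_append: "word_homeo (u @ v) z = word_homeo v (word_homeo u z)"
  by (induction u arbitrary: z) auto

lemma continuous_on_word_motion:
  assumes "continuous_on S f" "continuous_on S g"
  shows "continuous_on S (\<lambda>x. word_motion w (f x) (g x))"
  using assms
proof (induction w arbitrary: f g)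
  case (Cons x w)
  have "continuous_on S (\<lambda>y. letter_motion x (f y) (g y))"
    unfolding letter_motion_def using Cons.prems by (intro continuous_intros)
  with Cons.IH[of "\<lambda>y. f y - 1" "\<lambda>y. letter_motion x (f y) (g y)"] Cons.prems
  show ?case by (simp add: continuous_on_diff)
qed auto

definition inverse_word :: "braid_word \<Rightarrow> braid_word" where
  "inverse_word w = rev (map (\<lambda>(i, e). (i, \<not> e)) w)"

lemma inverse_word_simps [simp]:
  "inverse_word [] = []" "inverse_word ((i, e) # w) = inverse_word w @ [(i, \<not> e)]"
  "length (inverse_word w) = length w" "inverse_word (inverse_word w) = w"
  by (simp_all add: inverse_word_def rev_map comp_def case_prod_beta)

lemma letter_motion_reverse:
  "letter_motion (i, \<not> e) t (half_twist (i, e) z) = letter_motion (i, e) (1 - t) z"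
proof -
  have clamp: "max 0 (min 1 (1 - t)) = 1 - max 0 (min 1 t)" by auto
  show ?thesis
    unfolding half_twist_eq letter_motion_def fst_conv snd_conv twist_twist clamp
    by (cases e) (simp_all add: algebra_simps)
qed

text \<open>
  At integer times this says that inverse words give inverse homeomorphisms. The times in between are
  needed for the way back of a strand that has run round a block.
\<close>

lemma word_motion_reverse:
  fixes t :: real
  shows "word_motion (inverse_word w) t (word_homeo w z) = word_motion w (length w - t) z"
proof (induction w arbitrary: t z)
  case (Cons x w)
  obtain i e where x: "x = (i, e)" by fastforce
  have "word_motion (inverse_word (x # w)) t (word_homeo (x # w) z)
      = letter_motion (i, \<not> e) (t - length w) (word_motion w (length w - t) (half_twist x z))"
    by (simp add: x word_motion_append Cons.IH del: word_homeo.simps) (simp add: x Cons.IH)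
  also have "\<dots> = word_motion w (length w - t) (letter_motion x (1 + (length w - t)) z)"
  proof (cases "t \<le> length w")
    case True
    then show ?thesis by (simp add: letter_motion_start letter_motion_end)
  next
    case False
    then show ?thesis by (simp add: word_motion_start x letter_motion_reverse algebra_simps)
  qed
  finally show ?case by (simp add: algebra_simps)
qed simp

lemma word_homeo_inverse: "word_homeo (inverse_word w) (word_homeo w z) = z"
  using word_motion_reverse[of w "length w" z] by (simp add: word_motion_end word_motion_start)

lemma word_homeo_inverse': "word_homeo w (word_homeo (inverse_word w) z) = z"
  using word_homeo_inverse[of "inverse_word w" z] by simp

lemma cmod_of_nat_diff: "cmod (of_nat k - of_real x) = \<bar>real k - x\<bar>"
  by (metis norm_of_real of_real_diff of_real_of_nat_eq)

lemma letter_motion_far: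
  assumes "k \<noteq> i" "k \<noteq> i + 1"
  shows "letter_motion (i, e) t (of_nat k) = of_nat k"
proof -
  have "real k \<le> real i - 1 \<or> real k \<ge> real i + 2"
    using assms by linarith
  then have "1 \<le> \<bar>real k - (real i + 1 / 2)\<bar>" by linarith
  then show ?thesis
    unfolding letter_motion_def by (intro twist_outside) (metis fst_conv cmod_of_nat_diff)
qed

lemma letter_motion_near:
  assumes "k = i \<or> k = i + 1"
  shows "letter_motion (i, e) t (of_nat k) = of_real (real i + 1 / 2) +
     of_real (if k = i then - 1 / 2 else 1 / 2) * cis ((if e then - pi else pi) * max 0 (min 1 t))"
proof -
  have "\<bar>real k - (real i + 1 / 2)\<bar> \<le> 1 - 1 / 2"
    using assms by auto
  then have "cmod (of_nat k - of_real (real i + 1 / 2)) \<le> 1 - 1 / 2"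
    by (simp only: cmod_of_nat_diff)
  then show ?thesis
    using assms unfolding letter_motion_def fst_conv snd_conv
    by (subst twist_inside) auto
qed

lemma half_twist_of_nat:
  "half_twist (i, e) (of_nat k) = of_nat (Transposition.transpose i (i + 1) k)"
proof (cases "k = i \<or> k = i + 1")
  case True
  then show ?thesis
    by (auto simp: half_twist_eq letter_motion_near complex_eq_iff)
next
  case False
  then show ?thesis by (simp add: half_twist_eq letter_motion_far)
qed

lemma word_homeo_of_nat: "word_homeo w (of_nat k) = of_nat (end_position w k)"
  by (induction w arbitrary: k) (auto simp: half_twist_of_nat)

lemma braid_words_Cons: "(i, e) # w \<in> braid_words n \<longleftrightarrow> 1 \<le> i \<and> i < n \<and> w \<in> braid_words n"
  by (auto simp: braid_words_def)

lemma braid_words_append: "u @ v \<in> braid_words n \<longleftrightarrow> u \<in> braid_words n \<and> v \<in> braid_words n"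
  by (auto simp: braid_words_def)

lemma braid_words_inverse: "w \<in> braid_words n \<Longrightarrow> inverse_word w \<in> braid_words n"
  by (fastforce simp: braid_words_def inverse_word_def)

lemma disk_auto_letter_motion:
  assumes "1 \<le> i" "i < n"
  shows "disk_auto n (letter_motion (i, e) t)"
  unfolding letter_motion_def
proof (rule disk_auto_twist, rule cball_subset_disk)
  show "complex_of_real (real (fst (i, e)) + 1 / 2) = of_real (real i + 1 / 2)" by simp
qed (use assms in auto)

lemma disk_auto_word_motion: "w \<in> braid_words n \<Longrightarrow> disk_auto n (word_motion w t)"
proof (induction w arbitrary: t)
  case (Cons x w)
  obtain i e where "x = (i, e)" by fastforce
  with Cons show ?case
    using disk_auto_compose[OF disk_auto_letter_motion[of i n e t], of "word_motion w (t - 1)"]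
    by (simp add: braid_words_Cons)
qed (simp add: disk_auto_id cong: disk_auto_cong)

lemma disk_auto_word_homeo: "w \<in> braid_words n \<Longrightarrow> disk_auto n (word_homeo w)"
  using disk_auto_word_motion[of w n "length w"] by (simp add: word_motion_end cong: disk_auto_cong)

lemma end_position_in: "w \<in> braid_words n \<Longrightarrow> k \<in> {1..n} \<Longrightarrow> end_position w k \<in> {1..n}"
proof (induction w arbitrary: k)
  case (Cons x w)
  obtain i e where x: "x = (i, e)" by fastforce
  have "Transposition.transpose i (i + 1) k \<in> {1..n}"
    using Cons.prems x by (auto simp: Transposition.transpose_def braid_words_Cons)
  with Cons x show ?case by (simp add: braid_words_Cons)
qed simp

lemma end_position_inverse: "end_position (inverse_word w) (end_position w k) = k"
  using word_homeo_inverse[of w "of_nat k"] by (simp add: word_homeo_of_nat)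

lemma disk_homeo_word_homeo:
  assumes "w \<in> braid_words n"
  shows "disk_homeo n (word_homeo w)"
  unfolding disk_homeo_iff
proof
  show "disk_auto n (word_homeo w)" by (rule disk_auto_word_homeo[OF assms])
  have "word_homeo v z \<in> punctures n" if "v \<in> braid_words n" "z \<in> punctures n" for v z
    using that end_position_in unfolding punctures_def by (auto simp: word_homeo_of_nat simp del: atLeastAtMost_iff)
  with assms show "word_homeo w ` punctures n = punctures n"
    by (metis (no_types, lifting) braid_words_inverse image_eqI image_subsetI subset_antisym subsetI word_homeo_inverse')
qed


section \<open>Straightening motions of the punctures\<close>

text \<open>
  Moves each point \<open>a k\<close> to \<open>b k\<close>, provided that the points \<open>a k\<close> have mutual distances at least \<open>r\<close>.
  The displacement is a sum of cones of radius \<open>r\<close>; if the steps are short it has Lipschitz constant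
  \<open>1 / 2\<close>, so that \<open>push\<close>, the identity plus a contraction, is a homeomorphism.
\<close>

definition push :: "nat \<Rightarrow> real \<Rightarrow> (nat \<Rightarrow> complex) \<Rightarrow> (nat \<Rightarrow> complex) \<Rightarrow> complex \<Rightarrow> complex" where
  "push n r a b z = z + (\<Sum>k\<in>{1..n}. (b k - a k) * of_real (max 0 (1 - cmod (z - a k) / r)))"

lemma push_lipschitz:
  assumes "0 < r" and "\<And>k. k \<in> {1..n} \<Longrightarrow> cmod (b k - a k) \<le> r / (2 * real n)"
  shows "cmod ((push n r a b z - z) - (push n r a b w - w)) \<le> cmod (z - w) / 2"
proof -
  have bump: "\<bar>max 0 (1 - cmod (z - c) / r) - max 0 (1 - cmod (w - c) / r)\<bar> \<le> cmod (z - w) / r" for c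
  proof -
    have "\<bar>max 0 (1 - cmod (z - c) / r) - max 0 (1 - cmod (w - c) / r)\<bar>
        \<le> \<bar>cmod (z - c) / r - cmod (w - c) / r\<bar>" by linarith
    also have "\<dots> = \<bar>cmod (z - c) - cmod (w - c)\<bar> / r"
      using assms(1) by (simp add: diff_divide_distrib[symmetric])
    also have "\<bar>cmod (z - c) - cmod (w - c)\<bar> \<le> cmod (z - w)"
      using norm_triangle_ineq3[of "z - c" "w - c"] by simp
    finally show ?thesis using assms(1) by (simp add: divide_right_mono)
  qed
  have "(push n r a b z - z) - (push n r a b w - w) = (\<Sum>k\<in>{1..n}. (b k - a k) *
      of_real (max 0 (1 - cmod (z - a k) / r) - max 0 (1 - cmod (w - a k) / r)))"
    by (simp add: push_def sum_subtractf[symmetric] right_diff_distrib)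
  also have "cmod \<dots> \<le> (\<Sum>k\<in>{1..n}. (r / (2 * real n)) * (cmod (z - w) / r))"
  proof (rule sum_norm_le)
    fix k assume k: "k \<in> {1..n}"
    show "cmod ((b k - a k) * of_real (max 0 (1 - cmod (z - a k) / r) - max 0 (1 - cmod (w - a k) / r)))
        \<le> (r / (2 * real n)) * (cmod (z - w) / r)"
      unfolding norm_mult norm_of_real
      by (rule mult_mono[OF assms(2)[OF k] bump]) (use assms(1) in auto)
  qed
  also have "\<dots> \<le> cmod (z - w) / 2"
    using assms(1) by simp
  finally show ?thesis .
qed

lemma push_at:
  assumes "0 < r" "k \<in> {1..n}"
    and "\<And>l. l \<in> {1..n} \<Longrightarrow> l \<noteq> k \<Longrightarrow> r \<le> cmod (a k - a l)"
  shows "push n r a b (a k) = b k"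
proof -
  have "(\<Sum>l\<in>{1..n}. (b l - a l) * of_real (max 0 (1 - cmod (a k - a l) / r)))
      = (\<Sum>l\<in>{1..n}. if l = k then b k - a k else 0)"
  proof (rule sum.cong)
    fix l assume l: "l \<in> {1..n}"
    show "(b l - a l) * of_real (max 0 (1 - cmod (a k - a l) / r)) = (if l = k then b k - a k else 0)"
    proof (cases "l = k")
      case False
      then have "1 - cmod (a k - a l) / r \<le> 0" using assms(1) assms(3)[OF l] by simp
      with False show ?thesis by (simp add: max.absorb1)
    qed simp
  qed simp
  then show ?thesis using assms(2) by (simp add: push_def)
qed

lemma push_same: "(\<And>k. k \<in> {1..n} \<Longrightarrow> b k = a k) \<Longrightarrow> push n r a b z = z"
  by (simp add: push_def)

lemma disk_auto_push:
  assumes r: "0 < r" and small: "\<And>k. k \<in> {1..n} \<Longrightarrow> cmod (b k - a k) \<le> r / (2 * real n)"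
    and inside: "\<And>k. k \<in> {1..n} \<Longrightarrow> ball (a k) r \<subseteq> disk n"
  shows "disk_auto n (push n r a b)"
proof -
  let ?f = "push n r a b"
  have lip: "cmod ((?f z - z) - (?f w - w)) \<le> cmod (z - w) / 2" for z w
    by (rule push_lipschitz[OF r small])
  have fix_out: "?f z = z" if "z \<notin> interior (disk n)" for z
  proof -
    have "1 - cmod (z - a k) / r \<le> 0" if "k \<in> {1..n}" for k
    proof -
      have "z \<notin> ball (a k) r"
        using \<open>z \<notin> interior (disk n)\<close> interior_maximal[OF inside[OF that]] by auto
      then show ?thesis using r by (simp add: dist_norm norm_minus_commute field_simps)
    qed
    then have "(b k - a k) * of_real (max 0 (1 - cmod (z - a k) / r)) = 0" if "k \<in> {1..n}" for k
      using that by (simp add: max.absorb1)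
    then have "(\<Sum>k\<in>{1..n}. (b k - a k) * of_real (max 0 (1 - cmod (z - a k) / r))) = 0"
      by (rule sum.neutral[OF ballI])
    then show ?thesis by (simp only: push_def add_0_right)
  qed
  have inj: "z = w" if "?f z = ?f w" for z w
  proof -
    have "cmod (z - w) \<le> cmod (z - w) / 2"
      using lip[of z w] that by (simp add: norm_minus_commute)
    then show ?thesis by simp
  qed
  have to_disk: "?f z \<in> disk n" if "z \<in> disk n" for z
  proof (rule ccontr)
    assume *: "?f z \<notin> disk n"
    then have "?f (?f z) = ?f z" using fix_out interior_subset by blast
    with inj * that show False by metis
  qed
  have onto: "\<exists>z\<in>disk n. ?f z = y" if "y \<in> disk n" for y
  proof -
    \<comment> \<open>a preimage of \<open>y\<close> is a fixed point of a contraction\<close>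
    have "dist (y - (?f z - z)) (y - (?f w - w)) \<le> 1 / 2 * dist z w" for z w
      using lip[of w z] by (simp add: dist_norm norm_minus_commute algebra_simps)
    then obtain z where "y - (?f z - z) = z"
      using banach_fix_type[of "1/2" "\<lambda>z. y - (?f z - z)"] by auto
    then have "?f z = y" by (simp add: algebra_simps)
    moreover have "z \<in> disk n"
      using fix_out[of z] that calculation interior_subset by fastforce
    ultimately show ?thesis by blast
  qed
  have "continuous_on (disk n) ?f"
    unfolding push_def using r by (intro continuous_intros) auto
  moreover have "bij_betw ?f (disk n) (disk n)"
    unfolding bij_betw_def inj_on_def using inj to_disk onto by fastforce
  ultimately show ?thesis
    using fix_out by (auto simp: disk_auto_def frontier_def)
qed

definition disk_motion :: "nat \<Rightarrow> real \<Rightarrow> (real \<Rightarrow> complex \<Rightarrow> complex) \<Rightarrow> bool" where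
  "disk_motion n T F \<longleftrightarrow> continuous_on ({0..T} \<times> disk n) (\<lambda>(t, z). F t z) \<and>
     (\<forall>t\<in>{0..T}. disk_auto n (F t)) \<and> (\<forall>z\<in>disk n. F 0 z = z)"

lemma of_nat_in_disk: "k \<in> {1..n} \<Longrightarrow> of_nat k \<in> disk n"
  using punctures_subset[of n] by (auto simp: punctures_def image_subset_iff)

lemma disk_motion_interior:
  assumes "disk_motion n T F" "t \<in> {0..T}" "k \<in> {1..n}"
  shows "F t (of_nat k) \<in> interior (disk n)"
proof (rule disk_auto_interior[of n "F t"])
  show "disk_auto n (F t)" using assms by (simp add: disk_motion_def)
  show "of_nat k \<in> interior (disk n)"
    using assms(3) punctures_subset_interior[of n] by (auto simp: punctures_def image_subset_iff)
qed

text \<open>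
  If a motion carries the punctures along paths with room \<open>r\<close> between them, and the paths \<open>b\<close> stay
  close to these, composing the motion at each time with a push gives a motion along \<open>b\<close>. Where the
  paths agree the push is the identity, so the end map does not change.
\<close>

lemma motion_step:
  assumes F: "disk_motion n T F" and T: "0 < T" and r: "0 < r"
    and FT: "F T ` punctures n = punctures n"
    and cont: "\<And>k. k \<in> {1..n} \<Longrightarrow> continuous_on {0..T} (\<lambda>t. b t k)"
    and sep: "\<And>t k l. t \<in> {0..T} \<Longrightarrow> k \<in> {1..n} \<Longrightarrow> l \<in> {1..n} \<Longrightarrow> k \<noteq> l \<Longrightarrow>
      r \<le> cmod (F t (of_nat k) - F t (of_nat l))"
    and inside: "\<And>t k. t \<in> {0..T} \<Longrightarrow> k \<in> {1..n} \<Longrightarrow> ball (F t (of_nat k)) r \<subseteq> disk n"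
    and small: "\<And>t k. t \<in> {0..T} \<Longrightarrow> k \<in> {1..n} \<Longrightarrow>
      cmod (b t k - F t (of_nat k)) \<le> r / (2 * real n)"
    and ends: "\<And>k. k \<in> {1..n} \<Longrightarrow> b 0 k = of_nat k" "\<And>k. k \<in> {1..n} \<Longrightarrow> b T k = F T (of_nat k)"
  shows "\<exists>F'. disk_motion n T F' \<and> (\<forall>t\<in>{0..T}. \<forall>k\<in>{1..n}. F' t (of_nat k) = b t k) \<and>
    (\<forall>z\<in>disk n. F' T z = F T z)"
proof -
  define F' where "F' t z = push n r (\<lambda>k. F t (of_nat k)) (b t) (F t z)" for t z
  have Fcont: "continuous_on S (\<lambda>p. F (f p) (g p))"
    if "continuous_on S f" "continuous_on S g" "\<And>p. p \<in> S \<Longrightarrow> f p \<in> {0..T} \<and> g p \<in> disk n"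
    for S :: "(real \<times> complex) set" and f g
  proof -
    have "continuous_on S (\<lambda>p. (\<lambda>(t, z). F t z) (f p, g p))"
      by (rule continuous_on_compose2[of "{0..T} \<times> disk n"])
        (use that F in \<open>auto simp: disk_motion_def intro!: continuous_intros\<close>)
    then show ?thesis by simp
  qed
  have bcont: "continuous_on ({0..T} \<times> disk n) (\<lambda>p. b (fst p) k)" if "k \<in> {1..n}" for k
    by (rule continuous_on_compose2[OF cont[OF that]]) (auto intro!: continuous_intros)
  have "continuous_on ({0..T} \<times> disk n) (\<lambda>p. F' (fst p) (snd p))"
    unfolding F'_def push_def using r of_nat_in_disk
    by (intro continuous_intros Fcont bcont) auto
  moreover have "disk_auto n (F' t)" if "t \<in> {0..T}" for t
    unfolding F'_def
    by (rule disk_auto_compose[OF _ disk_auto_push[OF r]])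
      (use F that small inside in \<open>auto simp: disk_motion_def\<close>)
  moreover have "F' 0 z = z" if "z \<in> disk n" for z
  proof -
    have "F' 0 z = F 0 z"
      unfolding F'_def by (rule push_same) (use F ends(1) of_nat_in_disk in \<open>auto simp: disk_motion_def\<close>)
    with F that show ?thesis by (simp add: disk_motion_def)
  qed
  ultimately have "disk_motion n T F'"
    by (simp add: disk_motion_def case_prod_beta)
  moreover have "F' t (of_nat k) = b t k" if "t \<in> {0..T}" "k \<in> {1..n}" for t k
    unfolding F'_def using push_at[OF r that(2), of "\<lambda>k. F t (of_nat k)" "b t"] sep that by simp
  moreover have "F' T z = F T z" for z
    unfolding F'_def using ends(2) by (intro push_same) auto
  ultimately show ?thesis by blast
qed

lemma uniform_room:
  fixes d :: "'i \<Rightarrow> 'x::topological_space \<Rightarrow> real"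
  assumes "compact K" "finite I" "\<And>i. i \<in> I \<Longrightarrow> continuous_on K (d i)"
    "\<And>i x. i \<in> I \<Longrightarrow> x \<in> K \<Longrightarrow> 0 < d i x"
  shows "\<exists>r>0. \<forall>i\<in>I. \<forall>x\<in>K. r \<le> d i x"
  using assms(2-)
proof (induction I)
  case empty
  show ?case by (intro exI[of _ 1]) auto
next
  case (insert i I)
  then obtain r where r: "0 < r" "\<forall>i\<in>I. \<forall>x\<in>K. r \<le> d i x" by auto
  obtain r' where r': "0 < r'" "\<forall>x\<in>K. r' \<le> d i x"
  proof (cases "K = {}")
    case False
    then obtain x where "x \<in> K" "\<forall>y\<in>K. d i x \<le> d i y"
      using continuous_attains_inf[OF assms(1) False] insert.prems(1) by blast
    with insert.prems(2) that show ?thesis by blast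
  qed (auto intro: that[of 1])
  show ?case
    using r r' by (intro exI[of _ "min r r'"]) (auto simp: min.coboundedI1 min.coboundedI2)
qed

text \<open>
  The paths of the punctures are moved to the paths \<open>b\<close> along straight lines, in \<open>N\<close> steps that are so
  short that each is a push as in \<open>motion_step\<close>. By compactness the room available for the pushes is
  bounded below uniformly in time and in the position \<open>u\<close> on the straight line.
\<close>

lemma motion_straighten:
  assumes F: "disk_motion n T F" and T: "0 < T"
    and FT: "F T ` punctures n = punctures n"
    and cont: "\<And>k. k \<in> {1..n} \<Longrightarrow> continuous_on {0..T} (\<lambda>t. b t k)"
    and inside: "\<And>t k. t \<in> {0..T} \<Longrightarrow> k \<in> {1..n} \<Longrightarrow> b t k \<in> interior (disk n)"
    and ends: "\<And>k. k \<in> {1..n} \<Longrightarrow> b 0 k = of_nat k" "\<And>k. k \<in> {1..n} \<Longrightarrow> b T k = F T (of_nat k)"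
    and apart: "\<And>t u k l. t \<in> {0..T} \<Longrightarrow> u \<in> {0..1} \<Longrightarrow> k \<in> {1..n} \<Longrightarrow> l \<in> {1..n} \<Longrightarrow> k < l \<Longrightarrow>
      (1 - u) *\<^sub>R (F t (of_nat l) - F t (of_nat k)) + u *\<^sub>R (b t l - b t k) \<noteq> 0"
  shows "\<exists>F'. disk_motion n T F' \<and> (\<forall>t\<in>{0..T}. \<forall>k\<in>{1..n}. F' t (of_nat k) = b t k) \<and>
    (\<forall>z\<in>disk n. F' T z = F T z)"
proof -
  define h where "h u t k = (1 - u) *\<^sub>R F t (of_nat k) + u *\<^sub>R b t k" for u t k
  let ?K = "{0..1::real} \<times> {0..T}"
  have Fin: "F t (of_nat k) \<in> interior (disk n)" if "t \<in> {0..T}" "k \<in> {1..n}" for t k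
    by (rule disk_motion_interior[OF F that])
  have hin: "h u t k \<in> interior (disk n)" if "u \<in> {0..1}" "t \<in> {0..T}" "k \<in> {1..n}" for u t k
    unfolding h_def
    using convexD_alt[OF convex_interior[OF convex_disk] Fin inside, of t k t k u] that by auto
  have Fcont: "continuous_on {0..T} (\<lambda>t. F t (of_nat k))" if "k \<in> {1..n}" for k
  proof -
    have "continuous_on {0..T} (\<lambda>t. (\<lambda>(t, z). F t z) (t, of_nat k))"
      by (rule continuous_on_compose2[of "{0..T} \<times> disk n"])
        (use F that of_nat_in_disk in \<open>auto simp: disk_motion_def intro!: continuous_intros\<close>)
    then show ?thesis by simp
  qed
  have hcont: "continuous_on ?K (\<lambda>p. h (fst p) (snd p) k)" if "k \<in> {1..n}" for k
    unfolding h_def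
    by (intro continuous_intros continuous_on_compose2[OF Fcont[OF that]]
        continuous_on_compose2[OF cont[OF that]]) auto
  have neq: "h u t k \<noteq> h u t l" if "u \<in> {0..1}" "t \<in> {0..T}" "k \<in> {1..n}" "l \<in> {1..n}" "k \<noteq> l" for u t k l
  proof -
    have "h u t k \<noteq> h u t l" if "k \<in> {1..n}" "l \<in> {1..n}" "k < l" for k l
      using apart[OF \<open>t \<in> {0..T}\<close> \<open>u \<in> {0..1}\<close> that]
      by (auto simp: h_def algebra_simps)
    from this[of k l] this[of l k] that show ?thesis by (metis linorder_neqE_nat)
  qed
  obtain r1 where r1: "0 < r1" "\<And>u t k l. u \<in> {0..1} \<Longrightarrow> t \<in> {0..T} \<Longrightarrow> k \<in> {1..n} \<Longrightarrow> l \<in> {1..n} \<Longrightarrow>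
      k \<noteq> l \<Longrightarrow> r1 \<le> cmod (h u t k - h u t l)"
  proof -
    let ?I = "{(k, l). k \<in> {1..n} \<and> l \<in> {1..n} \<and> k \<noteq> l}"
    have "finite ?I"
      by (rule finite_subset[of _ "{1..n} \<times> {1..n}"]) auto
    then have "\<exists>r>0. \<forall>i\<in>?I. \<forall>p\<in>?K. r \<le> cmod (h (fst p) (snd p) (fst i) - h (fst p) (snd p) (snd i))"
      by (intro uniform_room) (use neq in \<open>auto intro!: continuous_intros hcont compact_Times\<close>)
    then show ?thesis using that by fastforce
  qed
  define c :: complex where "c = of_real ((real n + 1) / 2)"
  define \<rho> where "\<rho> = (real n + 1) / 2"
  have disk: "disk n = cball c \<rho>" and int: "interior (disk n) = ball c \<rho>"
    by (simp_all add: disk_def c_def \<rho>_def)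
  obtain r2 where r2: "0 < r2" "\<And>u t k. u \<in> {0..1} \<Longrightarrow> t \<in> {0..T} \<Longrightarrow> k \<in> {1..n} \<Longrightarrow>
      r2 \<le> \<rho> - dist c (h u t k)"
  proof -
    have "\<exists>r>0. \<forall>k\<in>{1..n}. \<forall>p\<in>?K. r \<le> \<rho> - dist c (h (fst p) (snd p) k)"
      by (intro uniform_room) (use hin in \<open>auto simp: int intro!: continuous_intros hcont compact_Times\<close>)
    then show ?thesis using that by fastforce
  qed
  define r where "r = min r1 r2"
  have r: "0 < r" using r1 r2 by (simp add: r_def)
  have ball: "ball (h u t k) r \<subseteq> disk n" if "u \<in> {0..1}" "t \<in> {0..T}" "k \<in> {1..n}" for u t k
  proof
    fix z assume "z \<in> ball (h u t k) r"
    then have "dist c z \<le> dist c (h u t k) + r"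
      using dist_triangle[of c z "h u t k"] by simp
    also have "\<dots> \<le> \<rho>" using r2(2)[OF that] by (simp add: r_def)
    finally show "z \<in> disk n" by (simp add: disk)
  qed
  \<comment> \<open>no straight line is longer than \<open>2 * \<rho>\<close>; the summand \<open>1\<close> avoids a division by zero for \<open>n = 0\<close>\<close>
  obtain N :: nat where N: "0 < N" "2 * \<rho> / real N \<le> r / (2 * real n + 1)"
  proof -
    obtain N :: nat where N': "2 * \<rho> / (r / (2 * real n + 1)) < real N"
      using reals_Archimedean2 by blast
    have "0 < \<rho>" by (simp add: \<rho>_def)
    moreover from this have "0 < 2 * \<rho> / (r / (2 * real n + 1))"
      using r by simp
    ultimately have "0 < real N" using N' by linarith
    moreover from this have "2 * \<rho> / real N \<le> r / (2 * real n + 1)"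
      using N' r by (simp add: field_simps)
    ultimately show ?thesis by (intro that) (simp_all only: of_nat_0_less_iff)
  qed
  have step: "\<exists>F'. disk_motion n T F' \<and> (\<forall>t\<in>{0..T}. \<forall>k\<in>{1..n}. F' t (of_nat k) = h (real j / real N) t k) \<and>
    (\<forall>z\<in>disk n. F' T z = F T z)" if "j \<le> N" for j
    using that
  proof (induction j)
    case 0
    with F show ?case by (intro exI[of _ F]) (simp add: h_def)
  next
    case (Suc j)
    then obtain F' where F': "disk_motion n T F'"
      "\<And>t k. t \<in> {0..T} \<Longrightarrow> k \<in> {1..n} \<Longrightarrow> F' t (of_nat k) = h (real j / real N) t k"
      "\<And>z. z \<in> disk n \<Longrightarrow> F' T z = F T z"
      by auto
    have j: "real j / real N \<in> {0..1}" "real (Suc j) / real N \<in> {0..1}"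
      using Suc.prems N by (auto simp: field_simps)
    have "\<exists>F''. disk_motion n T F'' \<and> (\<forall>t\<in>{0..T}. \<forall>k\<in>{1..n}. F'' t (of_nat k) = h (real (Suc j) / real N) t k) \<and>
      (\<forall>z\<in>disk n. F'' T z = F' T z)"
    proof (rule motion_step[OF F'(1) T r])
      have "F' T ` punctures n = F T ` punctures n"
        using F'(3) punctures_subset by (intro image_cong) auto
      with FT show "F' T ` punctures n = punctures n" by simp
      show "continuous_on {0..T} (\<lambda>t. h (real (Suc j) / real N) t k)" if "k \<in> {1..n}" for k
        unfolding h_def by (intro continuous_intros Fcont cont that)
      show "r \<le> cmod (F' t (of_nat k) - F' t (of_nat l))"
        if "t \<in> {0..T}" "k \<in> {1..n}" "l \<in> {1..n}" "k \<noteq> l" for t k l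
        using r1(2)[OF j(1) that] that by (simp add: F'(2) r_def)
      show "ball (F' t (of_nat k)) r \<subseteq> disk n" if "t \<in> {0..T}" "k \<in> {1..n}" for t k
        using ball[OF j(1) that] that by (simp add: F'(2))
      show "cmod (h (real (Suc j) / real N) t k - F' t (of_nat k)) \<le> r / (2 * real n)"
        if "t \<in> {0..T}" "k \<in> {1..n}" for t k
      proof -
        have "h (real (Suc j) / real N) t k - F' t (of_nat k) = (1 / real N) *\<^sub>R (b t k - F t (of_nat k))"
          using that by (simp add: F'(2) h_def scaleR_diff_right scaleR_left_distrib scaleR_left_diff_distrib add_divide_distrib)
        then have "cmod (h (real (Suc j) / real N) t k - F' t (of_nat k)) = cmod (b t k - F t (of_nat k)) / real N"
          by simp
        also have "cmod (b t k - F t (of_nat k)) \<le> 2 * \<rho>"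
          using dist_triangle2[of "b t k" "F t (of_nat k)" c] inside[OF that] Fin[OF that]
          by (simp add: int dist_norm norm_minus_commute)
        also have "2 * \<rho> / real N \<le> r / (2 * real n)"
          using N(2) frac_le[of r r "2 * real n" "2 * real n + 1"] r that by auto
        finally show ?thesis using N by (simp add: divide_right_mono)
      qed
      show "h (real (Suc j) / real N) 0 k = of_nat k" if "k \<in> {1..n}" for k
        using F that of_nat_in_disk[OF that] by (simp add: h_def ends disk_motion_def flip: scaleR_left_distrib)
      show "h (real (Suc j) / real N) T k = F' T (of_nat k)" if "k \<in> {1..n}" for k
        using that T by (simp add: F'(2) h_def ends flip: scaleR_left_distrib)
    qed
    then show ?case using F'(3) by auto
  qed
  from step[of N] N(1) show ?thesis
    by (simp add: h_def)
qed

text \<open>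
  Straighten \<open>F\<close> to a motion \<open>F'\<close> with the same end map that moves the punctures exactly as \<open>G\<close> does.
  Then each \<open>G t\<close> inverse after \<open>F' t\<close> fixes the punctures, so these maps, followed by \<open>G T\<close>, form an
  isotopy from \<open>G T\<close> to \<open>F T\<close>. The inverses \<open>Gi\<close> are given explicitly to have them jointly continuous.
\<close>

lemma isotopic_if_motions_apart:
  assumes F: "disk_motion n T F" and T: "0 < T"
    and FT: "F T ` punctures n = punctures n"
    and G: "disk_motion n T G"
    and inv: "continuous_on ({0..T} \<times> disk n) (\<lambda>(t, z). Gi t z)"
      "\<And>t. t \<in> {0..T} \<Longrightarrow> disk_auto n (Gi t)"
      "\<And>t z. t \<in> {0..T} \<Longrightarrow> z \<in> disk n \<Longrightarrow> Gi t (G t z) = z"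
      "\<And>z. z \<in> disk n \<Longrightarrow> G T (Gi T z) = z"
    and ends: "\<And>k. k \<in> {1..n} \<Longrightarrow> G T (of_nat k) = F T (of_nat k)"
    and apart: "\<And>t u k l. t \<in> {0..T} \<Longrightarrow> u \<in> {0..1} \<Longrightarrow> k \<in> {1..n} \<Longrightarrow> l \<in> {1..n} \<Longrightarrow> k < l \<Longrightarrow>
      (1 - u) *\<^sub>R (F t (of_nat l) - F t (of_nat k)) + u *\<^sub>R (G t (of_nat l) - G t (of_nat k)) \<noteq> 0"
  shows "isotopic n (G T) (F T)"
proof -
  have Gcont: "continuous_on {0..T} (\<lambda>t. G t (of_nat k))" if "k \<in> {1..n}" for k
  proof -
    have "continuous_on {0..T} (\<lambda>t. (\<lambda>(t, z). G t z) (t, of_nat k))"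
      by (rule continuous_on_compose2[of "{0..T} \<times> disk n"])
        (use G that of_nat_in_disk in \<open>auto simp: disk_motion_def intro!: continuous_intros\<close>)
    then show ?thesis by simp
  qed
  have Gin: "G t (of_nat k) \<in> interior (disk n)" if "t \<in> {0..T}" "k \<in> {1..n}" for t k
    by (rule disk_motion_interior[OF G that])
  have "\<exists>F'. disk_motion n T F' \<and> (\<forall>t\<in>{0..T}. \<forall>k\<in>{1..n}. F' t (of_nat k) = G t (of_nat k)) \<and>
    (\<forall>z\<in>disk n. F' T z = F T z)"
    by (rule motion_straighten[OF F T FT Gcont Gin])
      (use G of_nat_in_disk ends apart in \<open>auto simp: disk_motion_def\<close>)
  then obtain F' where F': "disk_motion n T F'"
    "\<And>t k. t \<in> {0..T} \<Longrightarrow> k \<in> {1..n} \<Longrightarrow> F' t (of_nat k) = G t (of_nat k)"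
    "\<And>z. z \<in> disk n \<Longrightarrow> F' T z = F T z"
    by blast
  have GT: "disk_auto n (G T)" using G T by (simp add: disk_motion_def)
  have GTp: "G T ` punctures n = punctures n"
  proof -
    have "G T ` punctures n = F T ` punctures n"
      using ends by (intro image_cong) (auto simp: punctures_def)
    with FT show ?thesis by simp
  qed
  show ?thesis
  proof (rule isotopicI[OF T, of n "\<lambda>t z. G T (Gi t (F' t z))"])
    have F'_in: "F' t z \<in> disk n" and Gi_in: "Gi t z \<in> disk n" if "t \<in> {0..T}" "z \<in> disk n" for t z
      using disk_auto_in_disk[OF _ that(2)] that(1) F'(1) inv(2)[OF that(1)]
      by (simp_all add: disk_motion_def)
    have "continuous_on ({0..T} \<times> disk n) (\<lambda>p. (fst p, F' (fst p) (snd p)))"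
      using F'(1) by (auto simp: disk_motion_def case_prod_beta intro!: continuous_intros)
    then have "continuous_on ({0..T} \<times> disk n) (\<lambda>p. (\<lambda>(t, z). Gi t z) (fst p, F' (fst p) (snd p)))"
      by (rule continuous_on_compose2[OF inv(1)]) (use F'_in in auto)
    then have Gi_F': "continuous_on ({0..T} \<times> disk n) (\<lambda>p. Gi (fst p) (F' (fst p) (snd p)))"
      by simp
    have "continuous_on (disk n) (G T)" using GT by (simp add: disk_auto_def)
    from continuous_on_compose2[OF this Gi_F']
    have "continuous_on ({0..T} \<times> disk n) (\<lambda>p. G T (Gi (fst p) (F' (fst p) (snd p))))"
      using F'_in Gi_in by (simp add: image_subset_iff)
    then show "continuous_on ({0..T} \<times> disk n) (\<lambda>(t, z). G T (Gi t (F' t z)))"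
      by (simp add: case_prod_beta)
    show "disk_homeo n (\<lambda>z. G T (Gi t (F' t z)))" if t: "t \<in> {0..T}" for t
      unfolding disk_homeo_iff
    proof
      show "disk_auto n (\<lambda>z. G T (Gi t (F' t z)))"
        using disk_auto_compose[OF disk_auto_compose[OF _ inv(2)[OF t]] GT, of "F' t"] F'(1) t
        by (simp add: disk_motion_def)
      have "(\<lambda>z. G T (Gi t (F' t z))) ` punctures n = G T ` punctures n"
        using F'(2)[OF t] inv(3)[OF t] of_nat_in_disk by (intro image_cong) (auto simp: punctures_def)
      with GTp show "(\<lambda>z. G T (Gi t (F' t z))) ` punctures n = punctures n" by simp
    qed
    have "0 \<in> {0..T}" "T \<in> {0..T}" using T by auto
    show "G T (Gi 0 (F' 0 z)) = G T z" if "z \<in> disk n" for z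
      using inv(3)[OF \<open>0 \<in> {0..T}\<close> that] that F'(1) G by (simp add: disk_motion_def)
    show "G T (Gi T (F' T z)) = F T z" if "z \<in> disk n" for z
      using F'(3)[OF that] inv(4) disk_auto_in_disk[of n "F T" z] F T that
      by (simp add: disk_motion_def)
  qed
qed


section \<open>A strand running round a block of strands\<close>

text \<open>
  The strand in position \<open>m + 1\<close> moves to position \<open>1\<close>, passing all the strands in between on the same
  side.
\<close>

primrec sweep :: "nat \<Rightarrow> bool \<Rightarrow> braid_word" where
  "sweep 0 e = []"
| "sweep (Suc m) e = (Suc m, e) # sweep m e"

lemma length_sweep [simp]: "length (sweep m e) = m"
  by (induction m) auto

lemma sweep_in: "m < n \<Longrightarrow> sweep m e \<in> braid_words n"
  by (induction m) (auto simp: braid_words_Cons, simp add: braid_words_def)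

lemma end_position_sweep:
  "1 \<le> k \<Longrightarrow> end_position (sweep m e) k = (if k = m + 1 then 1 else if k \<le> m then k + 1 else k)"
  by (induction m arbitrary: k) (auto simp: Transposition.transpose_def)

text \<open>
  The sense of rotation of the punctures in a letter, counterclockwise being positive.
\<close>

definition turn_sign :: "bool \<Rightarrow> real" where
  "turn_sign e = (if e then - 1 else 1)"

text \<open>
  Only the coarse shape of the motion matters for the straight-line comparison: the moving strand stays
  in one closed half plane, the block stays in the opposite one in its original order, and nothing
  reaches the points beyond position \<open>m + 1\<close>.
\<close>

lemma sweep_motion:
  fixes t :: real
  shows "0 \<le> turn_sign e * Im (word_motion (sweep m e) t (of_nat (Suc m)))
    \<and> (\<forall>j. 1 \<le> j \<and> j \<le> m \<longrightarrow> turn_sign e * Im (word_motion (sweep m e) t (of_nat j)) \<le> 0)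
    \<and> (\<forall>j l. 1 \<le> j \<and> j < l \<and> l \<le> m \<longrightarrow>
         Re (word_motion (sweep m e) t (of_nat j)) < Re (word_motion (sweep m e) t (of_nat l)))
    \<and> (\<forall>k. 1 \<le> k \<and> k \<le> Suc m \<longrightarrow> Re (word_motion (sweep m e) t (of_nat k)) \<le> real (Suc m))
    \<and> (\<forall>k. Suc m < k \<longrightarrow> word_motion (sweep m e) t (of_nat k) = of_nat k)"
proof (induction m arbitrary: t)
  case 0
  show ?case by auto
next
  case (Suc m)
  define \<sigma> where "\<sigma> = turn_sign"
  define F where "F m t k = word_motion (sweep m e) t (of_nat k)" for m t k
  note IH = Suc.IH[folded F_def \<sigma>_def]
  show ?case
  proof (cases "t \<le> 1")
    case True
    define \<tau> where "\<tau> = max 0 (min 1 t)"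
    have \<tau>: "0 \<le> pi * \<tau>" "pi * \<tau> \<le> pi" by (simp_all add: \<tau>_def)
    then have sin: "0 \<le> sin (pi * \<tau>)" by (rule sin_ge_zero)
    have F: "F (Suc m) t k = letter_motion (Suc m, e) t (of_nat k)" for k
      using True by (simp add: F_def word_motion_start)
    have far: "F (Suc m) t k = of_nat k" if "k \<noteq> Suc m" "k \<noteq> Suc (Suc m)" for k
      unfolding F using that by (intro letter_motion_far) auto
    have Re1: "Re (F (Suc m) t (Suc m)) = real (Suc m) + 1 / 2 - cos (pi * \<tau>) / 2"
      and Im1: "\<sigma> e * Im (F (Suc m) t (Suc m)) = - sin (pi * \<tau>) / 2"
      unfolding F by (subst letter_motion_near; simp add: \<tau>_def \<sigma>_def turn_sign_def)+
    have Re2: "Re (F (Suc m) t (Suc (Suc m))) = real (Suc m) + 1 / 2 + cos (pi * \<tau>) / 2"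
      and Im2: "\<sigma> e * Im (F (Suc m) t (Suc (Suc m))) = sin (pi * \<tau>) / 2"
      unfolding F by (subst letter_motion_near; simp add: \<tau>_def \<sigma>_def turn_sign_def)+
    have cos: "- 1 \<le> cos (pi * \<tau>)" "cos (pi * \<tau>) \<le> 1" by simp_all
    then have cos': "3 / 2 - cos (pi * \<tau>) / 2 \<le> 2" "3 / 2 + cos (pi * \<tau>) / 2 \<le> 2"
      by linarith+
    show ?thesis
      unfolding F_def[symmetric] \<sigma>_def[symmetric]
    proof (intro conjI allI impI)
      show "0 \<le> \<sigma> e * Im (F (Suc m) t (Suc (Suc m)))"
        using sin by (simp add: Im2)
      show "\<sigma> e * Im (F (Suc m) t j) \<le> 0" if "1 \<le> j \<and> j \<le> Suc m" for j
        using sin that by (cases "j = Suc m") (simp_all add: Im1 far)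
      show "Re (F (Suc m) t j) < Re (F (Suc m) t l)" if "1 \<le> j \<and> j < l \<and> l \<le> Suc m" for j l
      proof (cases "l = Suc m")
        case True
        with that have "Re (F (Suc m) t j) = real j" "real j < real (Suc m)" by (simp_all add: far)
        with cos(2) show ?thesis unfolding True Re1 by linarith
      next
        case False
        with that show ?thesis by (simp add: far)
      qed
      show "Re (F (Suc m) t k) \<le> real (Suc (Suc m))" if "1 \<le> k \<and> k \<le> Suc (Suc m)" for k
      proof -
        consider "k = Suc m" | "k = Suc (Suc m)" | "k \<le> m"
          using \<open>1 \<le> k \<and> k \<le> Suc (Suc m)\<close> by linarith
        then show ?thesis
          by cases (simp_all add: Re1 Re2 far cos')
      qed
      show "F (Suc m) t k = of_nat k" if "Suc (Suc m) < k" for k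
        using that by (simp add: far)
    qed
  next
    case False
    note IH = IH[of "t - 1"]
    have F: "F (Suc m) t k = F m (t - 1) (Transposition.transpose (Suc m) (Suc (Suc m)) k)" for k
      using False by (simp add: F_def letter_motion_end half_twist_of_nat)
    have top: "F (Suc m) t (Suc (Suc m)) = F m (t - 1) (Suc m)" by (simp add: F)
    have nxt: "F (Suc m) t (Suc m) = of_nat (Suc (Suc m))" using IH by (simp add: F)
    have low: "F (Suc m) t k = F m (t - 1) k" if "k \<le> m" for k
      using that by (simp add: F Transposition.transpose_def)
    show ?thesis
      unfolding F_def[symmetric] \<sigma>_def[symmetric]
    proof (intro conjI allI impI)
      show "0 \<le> \<sigma> e * Im (F (Suc m) t (Suc (Suc m)))"
        using IH by (simp add: top)
      show "\<sigma> e * Im (F (Suc m) t j) \<le> 0" if "1 \<le> j \<and> j \<le> Suc m" for j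
        using IH that by (cases "j = Suc m") (simp_all add: nxt low)
      show "Re (F (Suc m) t j) < Re (F (Suc m) t l)" if jl: "1 \<le> j \<and> j < l \<and> l \<le> Suc m" for j l
      proof (cases "l = Suc m")
        case True
        have "Re (F m (t - 1) j) \<le> real (Suc m)" using IH jl True by simp
        then show ?thesis using jl True by (simp add: nxt low)
      next
        case False
        then show ?thesis using jl IH by (simp add: low)
      qed
      show "Re (F (Suc m) t k) \<le> real (Suc (Suc m))" if k: "1 \<le> k \<and> k \<le> Suc (Suc m)" for k
      proof -
        consider "k = Suc m" | "k = Suc (Suc m)" | "k \<le> m" using k by linarith
        then show ?thesis
        proof cases
          case 2
          have "Re (F m (t - 1) (Suc m)) \<le> real (Suc m)" using IH by simp
          then show ?thesis by (simp add: 2 top)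
        next
          case 3
          have "Re (F m (t - 1) k) \<le> real (Suc m)" using IH k 3 by simp
          then show ?thesis by (simp add: 3 low)
        qed (simp add: nxt)
      qed
      show "F (Suc m) t k = of_nat k" if "Suc (Suc m) < k" for k
        using that IH by (simp add: F Transposition.transpose_def)
    qed
  qed
qed

lemmas sweep_motion_mover = sweep_motion[THEN conjunct1]
lemmas sweep_motion_block = sweep_motion[THEN conjunct2, THEN conjunct1, rule_format, OF conjI]
lemmas sweep_motion_order =
  sweep_motion[THEN conjunct2, THEN conjunct2, THEN conjunct1, rule_format, OF conjI, OF _ conjI]
lemmas sweep_motion_left =
  sweep_motion[THEN conjunct2, THEN conjunct2, THEN conjunct2, THEN conjunct1, rule_format, OF conjI]
lemmas sweep_motion_right =
  sweep_motion[THEN conjunct2, THEN conjunct2, THEN conjunct2, THEN conjunct2, rule_format]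

text \<open>
  The strand in position \<open>s + 1\<close> goes once round the strands in the positions \<open>1, \<dots>, s\<close> and returns:
  inverting the sweep of opposite sign leads it back on the other side of the block.
\<close>

definition loop_around :: "nat \<Rightarrow> bool \<Rightarrow> braid_word" where
  "loop_around s e = sweep s e @ inverse_word (sweep s (\<not> e))"

lemma length_loop_around: "length (loop_around s e) = 2 * s"
  by (simp add: loop_around_def)

lemma loop_around_in: "s < n \<Longrightarrow> loop_around s e \<in> braid_words n"
  by (simp add: loop_around_def braid_words_append braid_words_inverse sweep_in)

lemma end_position_loop_around:
  assumes "1 \<le> k" shows "end_position (loop_around s e) k = k"
proof -
  have "end_position (sweep s e) k = end_position (sweep s (\<not> e)) k"
    by (simp only: end_position_sweep[OF assms])
  then show ?thesis
    by (simp add: loop_around_def end_position_append end_position_inverse)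
qed

text \<open>
  The way back is the sweep of opposite sign run backwards, so that both halves of the loop are
  controlled by \<open>sweep_motion\<close>.
\<close>

lemma word_motion_loop_around:
  assumes "1 \<le> k"
  shows "t \<le> real s \<Longrightarrow> word_motion (loop_around s e) t (of_nat k) = word_motion (sweep s e) t (of_nat k)"
    and "real s \<le> t \<Longrightarrow> word_motion (loop_around s e) t (of_nat k)
      = word_motion (sweep s (\<not> e)) (2 * real s - t) (of_nat k)"
proof -
  show "word_motion (loop_around s e) t (of_nat k) = word_motion (sweep s e) t (of_nat k)"
    if "t \<le> real s"
    using that by (simp add: loop_around_def word_motion_append word_motion_start)
  have same: "word_homeo (sweep s e) (of_nat k) = word_homeo (sweep s (\<not> e)) (of_nat k)"
    by (simp only: word_homeo_of_nat end_position_sweep[OF assms])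
  show "word_motion (loop_around s e) t (of_nat k)
      = word_motion (sweep s (\<not> e)) (2 * real s - t) (of_nat k)" if "real s \<le> t"
    using that word_motion_reverse[of "sweep s (\<not> e)" "t - real s" "of_nat k"]
    by (simp add: loop_around_def word_motion_append word_motion_end same algebra_simps)
qed

definition block_centre :: "nat \<Rightarrow> complex" where
  "block_centre s = of_real ((real s + 1) / 2)"

text \<open>
  The outer disk, which contains the positions \<open>1, \<dots>, s + 1\<close>, rotates by \<open>\<theta>\<close> while the inner disk,
  which contains the block, rotates back by \<open>\<theta>\<close>. Together they translate the block along a small circle
  and move the strand \<open>s + 1\<close> round it, as in \<open>loop_around\<close>.
\<close>

definition orbit_motion :: "nat \<Rightarrow> real \<Rightarrow> complex \<Rightarrow> complex" where
  "orbit_motion s \<theta> z =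
     twist (block_centre (s + 1)) (real s / 2 + 1) \<theta> (twist (block_centre s) (real s / 2) (- \<theta>) z)"

definition orbit_motion_inv :: "nat \<Rightarrow> real \<Rightarrow> complex \<Rightarrow> complex" where
  "orbit_motion_inv s \<theta> z =
     twist (block_centre s) (real s / 2) \<theta> (twist (block_centre (s + 1)) (real s / 2 + 1) (- \<theta>) z)"

lemma orbit_motion_inverse:
  "orbit_motion_inv s \<theta> (orbit_motion s \<theta> z) = z" "orbit_motion s \<theta> (orbit_motion_inv s \<theta> z) = z"
  by (simp_all add: orbit_motion_def orbit_motion_inv_def twist_twist)

lemma disk_auto_orbit_motion:
  assumes "s < n"
  shows "disk_auto n (orbit_motion s \<theta>)" "disk_auto n (orbit_motion_inv s \<theta>)"
proof -
  have inner: "cball (block_centre s) (real s / 2) \<subseteq> disk n"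
    by (rule cball_subset_disk[OF block_centre_def]) (use assms in \<open>simp_all add: field_simps\<close>)
  have outer: "cball (block_centre (s + 1)) (real s / 2 + 1) \<subseteq> disk n"
    by (rule cball_subset_disk[OF block_centre_def]) (use assms in \<open>simp_all add: field_simps\<close>)
  show "disk_auto n (orbit_motion s \<theta>)"
    unfolding orbit_motion_def[abs_def]
    by (rule disk_auto_compose[OF disk_auto_twist[OF inner] disk_auto_twist[OF outer]])
  show "disk_auto n (orbit_motion_inv s \<theta>)"
    unfolding orbit_motion_inv_def[abs_def]
    by (rule disk_auto_compose[OF disk_auto_twist[OF outer] disk_auto_twist[OF inner]])
qed

lemma cmod_block_centre: "cmod (of_nat k - block_centre s) = \<bar>real k - (real s + 1) / 2\<bar>"
  unfolding block_centre_def by (rule cmod_of_nat_diff)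

lemma block_centre_Suc: "block_centre (Suc s) = block_centre s + 1 / 2"
  by (simp add: block_centre_def complex_eq_iff add_divide_distrib)

lemma orbit_motion_block:
  assumes "1 \<le> k" "k \<le> s"
  shows "orbit_motion s \<theta> (of_nat k) = of_nat k + (1 - cis \<theta>) / 2"
proof -
  let ?c = "block_centre s"
  have dist: "cmod (of_nat k - ?c) \<le> real s / 2 - 1 / 2"
    using assms by (simp add: cmod_block_centre abs_le_iff field_simps)
  have inner: "twist ?c (real s / 2) (- \<theta>) (of_nat k) = ?c + (of_nat k - ?c) * cis (- \<theta>)"
    by (rule twist_inside[OF dist])
  have "cmod (?c + (of_nat k - ?c) * cis (- \<theta>) - block_centre (s + 1))
      = cmod ((of_nat k - ?c) * cis (- \<theta>) - 1 / 2)"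
    by (simp add: block_centre_Suc diff_diff_eq[symmetric])
  also have "\<dots> \<le> cmod (of_nat k - ?c) + 1 / 2"
    using norm_triangle_ineq4[of "(of_nat k - ?c) * cis (- \<theta>)" "1 / 2"] by (simp add: norm_mult)
  finally have "cmod (?c + (of_nat k - ?c) * cis (- \<theta>) - block_centre (s + 1)) \<le> real s / 2 + 1 - 1 / 2"
    using dist by simp
  then have "orbit_motion s \<theta> (of_nat k) = block_centre (s + 1)
      + (?c + (of_nat k - ?c) * cis (- \<theta>) - block_centre (s + 1)) * cis \<theta>"
    unfolding orbit_motion_def inner by (rule twist_inside)
  also have "\<dots> = ?c + 1 / 2 + ((of_nat k - ?c) * (cis (- \<theta>) * cis \<theta>) - cis \<theta> / 2)"
    by (simp add: block_centre_Suc algebra_simps)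
  also have "\<dots> = of_nat k + (1 - cis \<theta>) / 2"
    by (simp add: cis_mult diff_divide_distrib)
  finally show ?thesis .
qed

lemma orbit_motion_mover:
  "orbit_motion s \<theta> (of_nat (s + 1)) = block_centre (s + 1) + of_real (real s / 2) * cis \<theta>"
proof -
  have "twist (block_centre s) (real s / 2) (- \<theta>) (of_nat (s + 1)) = of_nat (s + 1)"
    by (rule twist_outside, unfold cmod_block_centre) (simp add: field_simps abs_if)
  moreover have "twist (block_centre (s + 1)) (real s / 2 + 1) \<theta> (of_nat (s + 1))
      = block_centre (s + 1) + (of_nat (s + 1) - block_centre (s + 1)) * cis \<theta>"
    by (rule twist_inside, unfold cmod_block_centre) (simp add: field_simps abs_if)
  moreover have "of_nat (s + 1) - block_centre (s + 1) = of_real (real s / 2)"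
    by (simp add: block_centre_def complex_eq_iff field_simps)
  ultimately show ?thesis by (simp only: orbit_motion_def)
qed

lemma orbit_motion_outside:
  assumes "s + 1 < k"
  shows "orbit_motion s \<theta> (of_nat k) = of_nat k"
proof -
  have "twist (block_centre s) (real s / 2) (- \<theta>) (of_nat k) = of_nat k"
    by (rule twist_outside, unfold cmod_block_centre) (use assms in \<open>simp add: field_simps abs_if\<close>)
  moreover have "twist (block_centre (s + 1)) (real s / 2 + 1) \<theta> (of_nat k) = of_nat k"
    by (rule twist_outside, unfold cmod_block_centre) (use assms in \<open>simp add: field_simps abs_if\<close>)
  ultimately show ?thesis by (simp only: orbit_motion_def)
qed

definition block_circle :: "nat \<Rightarrow> complex set" where
  "block_circle s = sphere (block_centre s) (real s / 2)"

text \<open>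
  The circle bounds the inner twist, which does not move it, and lies in the rigid part of the outer
  twist, which has come back to its initial position after a full turn.
\<close>

lemma orbit_motion_full_turn:
  assumes "z \<in> block_circle s" "cis \<theta> = 1"
  shows "orbit_motion s \<theta> z = z"
proof -
  have z: "cmod (z - block_centre s) = real s / 2"
    using assms(1) by (simp add: block_circle_def dist_norm norm_minus_commute)
  have "cmod (z - block_centre (s + 1)) \<le> real s / 2 + 1 - 1 / 2"
    using norm_triangle_ineq4[of "z - block_centre s" "1 / 2"] z
    by (simp add: block_centre_Suc diff_diff_eq[symmetric])
  then show ?thesis
    using z assms(2) by (simp add: orbit_motion_def twist_outside twist_inside)
qed

lemma continuous_on_orbit_motion:
  assumes "continuous_on S f" "continuous_on S g"
  shows "continuous_on S (\<lambda>x. orbit_motion s (f x) (g x))" "continuous_on S (\<lambda>x. orbit_motion_inv s (f x) (g x))"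
  unfolding orbit_motion_def orbit_motion_inv_def using assms by (intro continuous_intros; simp)+

text \<open>
  The word motion and the orbit motion are compared at equal times, each taking the time \<open>2 * s\<close> in
  total. Straight lines between them keep the punctures apart: two strands of the block are ordered by
  their real parts in the same way in both motions, and so are a strand beyond position \<open>s + 1\<close> and any
  other one. The vector from a strand of the block to the moving strand lies in the same closed half
  plane in both motions; for the orbit motion it lies in the interior except at the times \<open>0\<close>, \<open>s\<close> and
  \<open>2 * s\<close>, when the two motions agree.
\<close>

lemma loop_around_isotopic:
  assumes s: "1 \<le> s" "s < n"
  shows "isotopic n (word_homeo (loop_around s e)) (orbit_motion s (turn_sign e * 2 * pi))"
proof -
  define \<sigma> where "\<sigma> = turn_sign"
  define \<theta> where "\<theta> t = \<sigma> e * pi * t / real s" for t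
  define T where "T = 2 * real s"
  define F where "F = word_motion (loop_around s e)"
  define G where "G t = orbit_motion s (\<theta> t)" for t
  have T: "0 < T" using s by (simp add: T_def)
  have FT: "F T = word_homeo (loop_around s e)"
    by (simp add: F_def T_def fun_eq_iff word_motion_end length_loop_around)
  have \<theta>T: "\<theta> T = \<sigma> e * 2 * pi" using s by (simp add: \<theta>_def T_def)
  have w: "loop_around s e \<in> braid_words n" by (rule loop_around_in[OF s(2)])
  have Fmotion: "disk_motion n T F"
    unfolding disk_motion_def F_def case_prod_beta
    by (auto intro!: continuous_on_word_motion continuous_intros disk_auto_word_motion[OF w]
        simp: word_motion_start)
  have \<theta>_cont: "continuous_on A (\<lambda>p. \<theta> (fst p))" for A :: "(real \<times> complex) set"
    unfolding \<theta>_def by (intro continuous_intros) (use s in auto)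
  have Gmotion: "disk_motion n T G"
    unfolding disk_motion_def G_def case_prod_beta
  proof (intro conjI ballI)
    show "continuous_on ({0..T} \<times> disk n) (\<lambda>p. orbit_motion s (\<theta> (fst p)) (snd p))"
      by (intro continuous_on_orbit_motion \<theta>_cont continuous_intros)
    show "orbit_motion s (\<theta> 0) z = z" for z
      by (simp add: \<theta>_def orbit_motion_def)
  qed (rule disk_auto_orbit_motion[OF s(2)])
  have Gblock: "G t (of_nat k) = of_nat k + (1 - cis (\<theta> t)) / 2" if "1 \<le> k" "k \<le> s" for t k
    unfolding G_def by (rule orbit_motion_block[OF that])
  have Gmover: "G t (of_nat (Suc s)) = block_centre (s + 1) + of_real (real s / 2) * cis (\<theta> t)" for t
    using orbit_motion_mover[of s "\<theta> t"] by (simp add: G_def)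
  have Gout: "G t (of_nat k) = of_nat k" if "Suc s < k" for t k
    unfolding G_def using that by (intro orbit_motion_outside) simp
  have F1: "F t (of_nat k) = word_motion (sweep s e) t (of_nat k)" if "t \<le> real s" "1 \<le> k" for t k
    unfolding F_def using that by (intro word_motion_loop_around)
  have F2: "F t (of_nat k) = word_motion (sweep s (\<not> e)) (2 * real s - t) (of_nat k)"
    if "real s \<le> t" "1 \<le> k" for t k
    unfolding F_def using that by (intro word_motion_loop_around)
  have Forder: "Re (F t (of_nat j)) < Re (F t (of_nat l))" if "1 \<le> j" "j < l" "l \<le> s" for t j l
    using F1[of t] F2[of t] that sweep_motion_order by (cases "t \<le> real s") auto
  have Fleft: "Re (F t (of_nat k)) \<le> real (Suc s)" if "1 \<le> k" "k \<le> Suc s" for t k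
    using F1[of t k] F2[of t k] that sweep_motion_left[of k s] by (cases "t \<le> real s") auto
  have Fout: "F t (of_nat k) = of_nat k" if "Suc s < k" for t k
    using F1[of t k] F2[of t k] that sweep_motion_right[of s k] by (cases "t \<le> real s") auto
  have Fim: "0 \<le> (if t \<le> real s then \<sigma> e else - \<sigma> e) * Im (F t (of_nat (Suc s)) - F t (of_nat k))"
    if "1 \<le> k" "k \<le> s" for t k
  proof (cases "t \<le> real s")
    case True
    then show ?thesis
      using sweep_motion_mover[of e s t] sweep_motion_block[OF that, of e t] that
      by (simp add: F1 \<sigma>_def turn_sign_def algebra_simps del: of_nat_Suc split: if_splits)
  next
    case False
    then show ?thesis
      using sweep_motion_mover[of "\<not> e" s "2 * real s - t"] sweep_motion_block[OF that, of "\<not> e" "2 * real s - t"] that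
      by (simp add: F2 \<sigma>_def turn_sign_def algebra_simps del: of_nat_Suc split: if_splits)
  qed
  have Gdiff: "G t (of_nat (Suc s)) - G t (of_nat k)
      = of_real ((real s + 1) / 2 - real k) + of_real ((real s + 1) / 2) * cis (\<theta> t)"
    if "1 \<le> k" "k \<le> s" for t k
    unfolding Gmover Gblock[OF that] by (simp add: block_centre_def complex_eq_iff field_simps)
  have Fend: "F t (of_nat k) = G t (of_nat k)"
    if t: "t = 0 \<or> t = real s \<or> t = T" and k: "1 \<le> k" "k \<le> Suc s" for t k
  proof -
    have cis: "cis (\<theta> t) = (if t = real s then - 1 else 1)"
      using t s by (auto simp: \<theta>_def T_def \<sigma>_def turn_sign_def complex_eq_iff)
    have "G t (of_nat k) = of_nat (if t = real s then end_position (sweep s e) k else k)"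
    proof (cases "k = Suc s")
      case True
      have "G t (of_nat (Suc s)) = of_nat (if t = real s then 1 else Suc s)"
        unfolding Gmover cis by (simp add: block_centre_def complex_eq_iff field_simps)
      then show ?thesis
        using True k by (simp add: end_position_sweep del: of_nat_Suc)
    next
      case False
      with k have "k \<le> s" by simp
      with k show ?thesis
        by (simp add: Gblock cis end_position_sweep)
    qed
    moreover have "F t (of_nat k) = of_nat (if t = real s then end_position (sweep s e) k else k)"
      using t k s end_position_loop_around[OF k(1), of s e]
      by (auto simp: F_def word_motion_start word_motion_end length_loop_around T_def
          word_homeo_of_nat word_motion_loop_around)
    ultimately show ?thesis by simp
  qed
  have "isotopic n (G T) (F T)"
  proof (rule isotopic_if_motions_apart[OF Fmotion T _ Gmotion, where Gi = "\<lambda>t. orbit_motion_inv s (\<theta> t)"])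
    show "F T ` punctures n = punctures n"
      using disk_homeo_word_homeo[OF w] by (simp add: FT disk_homeo_iff)
    show "continuous_on ({0..T} \<times> disk n) (\<lambda>(t, z). orbit_motion_inv s (\<theta> t) z)"
      unfolding case_prod_beta by (intro continuous_on_orbit_motion \<theta>_cont continuous_intros)
    show "G T (of_nat k) = F T (of_nat k)" if "k \<in> {1..n}" for k
      using Fend[of T k] Gout[of k T] Fout[of k T] that by (cases "k \<le> Suc s") auto
    show "(1 - u) *\<^sub>R (F t (of_nat l) - F t (of_nat k)) + u *\<^sub>R (G t (of_nat l) - G t (of_nat k)) \<noteq> 0"
      (is "?d \<noteq> 0") if t: "t \<in> {0..T}" and u: "u \<in> {0..1}" and kl: "k \<in> {1..n}" "l \<in> {1..n}" "k < l" for t u k l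
    proof -
      have comb: "0 < (1 - u) * x + u * y" if "0 < x" "0 < y" for x y :: real
        using u that by (cases "u = 0") (auto intro!: add_nonneg_pos)
      have Re_pos: "?d \<noteq> 0" if "0 < Re (F t (of_nat l) - F t (of_nat k))" "0 < Re (G t (of_nat l) - G t (of_nat k))"
      proof
        assume "?d = 0"
        then have "Re ?d = 0" by (simp only: zero_complex.sel)
        with comb[OF that] show False by simp
      qed
      consider "l \<le> s" | "l = Suc s" | "Suc s < l" by linarith
      then show ?thesis
      proof cases
        case 1
        with kl show ?thesis
          by (intro Re_pos) (simp_all add: Forder Gblock)
      next
        case 2
        with kl have k: "1 \<le> k" "k \<le> s" by auto
        have Fne: "F t (of_nat l) \<noteq> F t (of_nat k)"
          using Fmotion t kl disk_auto_inj[of n "F t", OF _ of_nat_in_disk of_nat_in_disk, of l k]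
          by (auto simp: disk_motion_def)
        show ?thesis
        proof (cases "t = 0 \<or> t = real s \<or> t = T")
          case True
          then have "G t (of_nat l) - G t (of_nat k) = F t (of_nat l) - F t (of_nat k)"
            using Fend[OF True, of k] Fend[OF True, of l] k 2 by simp
          then have "?d = F t (of_nat l) - F t (of_nat k)"
            by (simp flip: scaleR_left_distrib)
          with Fne show ?thesis by simp
        next
          case False
          define \<sigma>' where "\<sigma>' = (if t \<le> real s then \<sigma> e else - \<sigma> e)"
          have "0 < (if t \<le> real s then 1 else - 1) * sin (pi * t / real s)"
          proof (cases "t \<le> real s")
            case True
            with False t s have "0 < pi * t / real s" "pi * t / real s < pi"
              by (auto simp: field_simps)
            then show ?thesis using True by (simp add: sin_gt_zero)
          next
            case gt: False
            with False t s have "0 < pi * t / real s - pi" "pi * t / real s - pi < pi"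
              by (auto simp: field_simps T_def)
            then have "0 < sin (pi * t / real s - pi)" by (rule sin_gt_zero)
            then show ?thesis using gt by (simp add: sin_diff)
          qed
          then have "0 < \<sigma>' * sin (\<theta> t)"
            by (auto simp: \<sigma>'_def \<theta>_def \<sigma>_def turn_sign_def split: if_splits)
          then have G_pos: "0 < \<sigma>' * Im (G t (of_nat l) - G t (of_nat k))"
            using Gdiff[OF k, of t] 2 s by (simp add: mult.left_commute[of \<sigma>'] del: of_nat_Suc)
          have F_nonneg: "0 \<le> \<sigma>' * Im (F t (of_nat l) - F t (of_nat k))"
            using Fim[OF k, of t] 2 by (simp only: \<sigma>'_def)
          show ?thesis
          proof (cases "u = 0")
            case True
            with Fne show ?thesis by simp
          next
            case False
            have "\<sigma>' * Im ?d = (1 - u) * (\<sigma>' * Im (F t (of_nat l) - F t (of_nat k)))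
                + u * (\<sigma>' * Im (G t (of_nat l) - G t (of_nat k)))"
              by (simp add: algebra_simps)
            also have "0 < \<dots>"
              using u False
                by (intro add_nonneg_pos mult_nonneg_nonneg[OF _ F_nonneg] mult_pos_pos[OF _ G_pos]) auto
            finally have "Im ?d \<noteq> 0" by fastforce
            then show ?thesis by (metis zero_complex.sel(2))
          qed
        qed
      next
        case 3
        have "Re (F t (of_nat k)) < real l"
          using Fleft[of k t] Fout[of k t] 3 kl by (cases "k \<le> Suc s") auto
        moreover have "Re (G t (of_nat k)) < real l"
        proof -
          consider "k \<le> s" | "k = Suc s" | "Suc s < k" by linarith
          then show ?thesis
          proof cases
            case 1
            have "real k + (1 - cos (\<theta> t)) / 2 \<le> real k + 1"
              using cos_ge_minus_one[of "\<theta> t"] by simp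
            also have "\<dots> < real l" using 1 3 by linarith
            finally show ?thesis using 1 kl by (simp add: Gblock)
          next
            case 2
            define x where "x = real s * cos (\<theta> t)"
            have "x \<le> real s" unfolding x_def by (rule mult_left_le) auto
            then have "(2 + real s) / 2 + x / 2 \<le> real s + 1" by (simp add: field_simps)
            also have "\<dots> < real l" using 3 by linarith
            finally have "(2 + real s) / 2 + x / 2 < real l" .
            then show ?thesis unfolding 2 Gmover by (simp add: block_centre_def x_def)
          qed (use kl in \<open>simp add: Gout\<close>)
        qed
        ultimately show ?thesis
          using 3 by (intro Re_pos) (simp_all add: Gout Fout)
      qed
    qed
  qed (use disk_auto_orbit_motion[OF s(2)] in \<open>auto simp: G_def orbit_motion_inverse\<close>)
  then show ?thesis
    unfolding FT by (simp add: G_def \<theta>T homotopic_with_sym \<sigma>_def)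
qed


section \<open>Symmetry of the crossing matrix\<close>

lemma word_crossing_self: "word_crossing w k k = 0"
  by (induction w arbitrary: k) auto

text \<open>
  A positive crossing adds \<open>1\<close> to the entry of the right strand, a negative one subtracts \<open>1\<close> from the
  entry of the left strand: both change the difference by \<open>1\<close> and exchange left and right.
\<close>

lemma word_crossing_swap:
  assumes "k \<noteq> l"
  shows "word_crossing w l k - word_crossing w k l
    = of_bool (end_position w l < end_position w k) - of_bool (l < k)"
  using assms
proof (induction w arbitrary: k l)
  case (Cons x w)
  obtain i e where x: "x = (i, e)" by fastforce
  have "Transposition.transpose i (i + 1) k \<noteq> Transposition.transpose i (i + 1) l"
    using Cons.prems by (auto simp: Transposition.transpose_def split: if_splits)
  note IH = Cons.IH[OF this]
  show ?case
    using IH Cons.prems by (auto simp: x Transposition.transpose_def split: if_splits)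
qed simp

lemma word_crossing_sym:
  assumes "end_position w k = k" "end_position w l = l"
  shows "word_crossing w k l = word_crossing w l k"
  using word_crossing_swap[of k l w] assms by (cases "k = l") auto

lemma word_crossing_inverse:
  "word_crossing (inverse_word w) (end_position w k) (end_position w l) = - word_crossing w k l"
proof (induction w arbitrary: k l)
  case (Cons x w)
  obtain i e where x: "x = (i, e)" by fastforce
  show ?case
    by (simp add: x word_crossing_append Cons.IH end_position_inverse)
      (auto simp: Transposition.transpose_def)
qed simp


section \<open>Matrices of braids that preserve a curve\<close>

text \<open>
  The curve is fixed pointwise, rather than mapped to itself, because this property is visibly closed
  under composition and conjugation.
\<close>

definition realized :: "nat \<Rightarrow> complex set \<Rightarrow> (nat \<Rightarrow> nat \<Rightarrow> int) \<Rightarrow> bool" where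
  "realized n C A \<longleftrightarrow> (\<exists>w\<in>braid_words n. (\<forall>k\<in>{1..n}. end_position w k = k) \<and>
     (\<forall>k\<in>{1..n}. \<forall>l\<in>{1..n}. word_crossing w k l = A k l) \<and>
     (\<exists>g. isotopic n (word_homeo w) g \<and> (\<forall>z\<in>C. g z = z)))"

lemma realized_cong:
  assumes "\<And>k l. k \<in> {1..n} \<Longrightarrow> l \<in> {1..n} \<Longrightarrow> A k l = B k l"
  shows "realized n C A \<longleftrightarrow> realized n C B"
  using assms unfolding realized_def by auto

lemma Nil_in_braid_words: "[] \<in> braid_words n"
  by (simp add: braid_words_def)

lemma realized_zero: "realized n C (\<lambda>k l. 0)"
  unfolding realized_def
  by (intro bexI[OF _ Nil_in_braid_words] conjI exI[of _ "word_homeo []"]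
      isotopic_refl[OF disk_homeo_word_homeo[OF Nil_in_braid_words]]) auto

lemma realized_add:
  assumes "realized n C A" "realized n C B"
  shows "realized n C (\<lambda>k l. A k l + B k l)"
proof -
  obtain v g where v: "v \<in> braid_words n" "\<forall>k\<in>{1..n}. end_position v k = k"
    "\<forall>k\<in>{1..n}. \<forall>l\<in>{1..n}. word_crossing v k l = A k l"
    "isotopic n (word_homeo v) g" "\<forall>z\<in>C. g z = z"
    using assms(1) by (auto simp: realized_def)
  obtain w h where w: "w \<in> braid_words n" "\<forall>k\<in>{1..n}. end_position w k = k"
    "\<forall>k\<in>{1..n}. \<forall>l\<in>{1..n}. word_crossing w k l = B k l"
    "isotopic n (word_homeo w) h" "\<forall>z\<in>C. h z = z"
    using assms(2) by (auto simp: realized_def)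
  have "word_homeo (v @ w) = (\<lambda>z. word_homeo w (word_homeo v z))"
    by (simp add: word_homeo_append fun_eq_iff)
  with isotopic_compose[OF v(4) w(4)] v w show ?thesis
    unfolding realized_def
    by (intro bexI[of _ "v @ w"] conjI exI[of _ "\<lambda>z. h (g z)"])
      (auto simp: braid_words_append end_position_append word_crossing_append)
qed

lemma realized_sum:
  "finite I \<Longrightarrow> (\<And>i. i \<in> I \<Longrightarrow> realized n C (A i)) \<Longrightarrow> realized n C (\<lambda>k l. \<Sum>i\<in>I. A i k l)"
  by (induction I rule: finite_induct) (auto intro: realized_zero realized_add)

lemma realized_scale:
  assumes "realized n C A" "realized n C (\<lambda>k l. - A k l)"
  shows "realized n C (\<lambda>k l. c * A k l)"
proof (induction c rule: int_induct[where k = 0])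
  case base
  show ?case by (simp add: realized_zero)
next
  case (step1 i)
  from realized_add[OF step1(2) assms(1)] show ?case by (simp add: algebra_simps)
next
  case (step2 i)
  from realized_add[OF step2(2) assms(2)] show ?case by (simp add: algebra_simps)
qed

text \<open>
  Conjugating by a generator renumbers two adjacent strands; the crossings with the generator cancel.
\<close>

lemma realized_conjugate:
  assumes A: "realized n C A" and i: "1 \<le> i" "i < n"
  shows "realized n (half_twist (i, False) ` C)
    (\<lambda>k l. A (Transposition.transpose i (i + 1) k) (Transposition.transpose i (i + 1) l))"
proof -
  let ?t = "Transposition.transpose i (i + 1)"
  let ?h = "\<lambda>e. word_homeo [(i, e)]"
  obtain w g where w: "w \<in> braid_words n" "\<forall>k\<in>{1..n}. end_position w k = k"
    "\<forall>k\<in>{1..n}. \<forall>l\<in>{1..n}. word_crossing w k l = A k l"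
    "isotopic n (word_homeo w) g" "\<forall>z\<in>C. g z = z"
    using A by (auto simp: realized_def)
  have t: "?t k \<in> {1..n}" if "k \<in> {1..n}" for k
    using that i by (auto simp: Transposition.transpose_def)
  have letter: "[(i, e)] \<in> braid_words n" for e
    using i by (simp add: braid_words_Cons Nil_in_braid_words)
  have conj: "isotopic n (word_homeo ((i, True) # w @ [(i, False)])) (\<lambda>z. ?h False (g (?h True z)))"
  proof -
    have "word_homeo ((i, True) # w @ [(i, False)])
        = (\<lambda>z. ?h False (word_homeo w (?h True z)))"
      by (simp add: word_homeo_append fun_eq_iff)
    then show ?thesis
      using isotopic_compose[OF isotopic_compose[OF isotopic_refl w(4)] isotopic_refl]
        disk_homeo_word_homeo[OF letter] by metis
  qed
  have untwist: "?h True (?h False z) = z" for z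
    using word_homeo_inverse[of "[(i, False)]" z] by simp
  have ends: "end_position ((i, True) # w @ [(i, False)]) k = k" if "k \<in> {1..n}" for k
    using w(2) t[OF that] by (simp add: end_position_append)
  have crossings: "word_crossing ((i, True) # w @ [(i, False)]) k l = A (?t k) (?t l)"
    if "k \<in> {1..n}" "l \<in> {1..n}" for k l
    using w(2,3) t[OF that(1)] t[OF that(2)]
    by (simp add: word_crossing_append) (auto simp: Transposition.transpose_def)
  show ?thesis
    unfolding realized_def
  proof (intro bexI[of _ "(i, True) # w @ [(i, False)]"] conjI exI[of _ "\<lambda>z. ?h False (g (?h True z))"])
    show "\<forall>z\<in>half_twist (i, False) ` C. ?h False (g (?h True z)) = z"
      using w(5) untwist by simp
    show "(i, True) # w @ [(i, False)] \<in> braid_words n"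
      using w(1) i by (simp add: braid_words_Cons braid_words_append Nil_in_braid_words)
  qed (use conj ends crossings in auto)
qed

text \<open>
  The open disk of radius \<open>1\<close> that supports the half twist lies inside the circle if \<open>i < s\<close>, and
  outside it if \<open>s < i\<close>.
\<close>

lemma half_twist_fixes_block_circle:
  assumes i: "1 \<le> i" "i \<noteq> s" and z: "z \<in> block_circle s"
  shows "half_twist (i, e) z = z"
proof -
  have "cmod (z - block_centre s) = real s / 2"
    using z by (simp add: block_circle_def dist_norm norm_minus_commute)
  moreover have "cmod (block_centre s - of_real (real i + 1 / 2)) = \<bar>(real s + 1) / 2 - (real i + 1 / 2)\<bar>"
    unfolding block_centre_def by (simp only: norm_of_real flip: of_real_diff)
  moreover have "\<bar>(real s + 1) / 2 - (real i + 1 / 2)\<bar> \<le> real s / 2 - 1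
      \<or> real s / 2 + 1 \<le> \<bar>(real s + 1) / 2 - (real i + 1 / 2)\<bar>"
  proof (cases "i < s")
    case True
    then have "real i + 1 \<le> real s" "1 \<le> real i" using i by auto
    then show ?thesis by (intro disjI1 abs_leI) (simp_all add: field_simps)
  next
    case False
    then have "real s + 1 \<le> real i" using i by linarith
    then show ?thesis by (auto simp: abs_if field_simps)
  qed
  ultimately have "1 \<le> cmod (z - of_real (real i + 1 / 2))"
    using norm_triangle_ineq2[of "z - block_centre s" "of_real (real i + 1 / 2) - block_centre s"]
      norm_triangle_ineq2[of "of_real (real i + 1 / 2) - block_centre s" "z - block_centre s"]
      norm_minus_commute[of z "of_real (real i + 1 / 2)"]
      norm_minus_commute[of "block_centre s" "of_real (real i + 1 / 2)"]
    by (simp add: algebra_simps) linarith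
  then show ?thesis
    by (simp add: half_twist_eq letter_motion_def twist_outside)
qed

lemma realized_permute:
  assumes A: "realized n (block_circle s) A" and i: "1 \<le> i" "i < n" "i \<noteq> s"
  shows "realized n (block_circle s)
    (\<lambda>k l. A (Transposition.transpose i (i + 1) k) (Transposition.transpose i (i + 1) l))"
proof -
  have "half_twist (i, False) ` block_circle s = block_circle s"
    using half_twist_fixes_block_circle[of i s] i by force
  with realized_conjugate[OF A i(1,2)] show ?thesis by simp
qed

definition edge :: "nat \<Rightarrow> nat \<Rightarrow> nat \<Rightarrow> nat \<Rightarrow> int" where
  "edge a b k l = of_bool (k = a \<and> l = b \<or> k = b \<and> l = a)"

definition star :: "nat \<Rightarrow> nat \<Rightarrow> nat \<Rightarrow> nat \<Rightarrow> int" where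
  "star s a k l = of_bool (k = a \<and> l \<le> s \<or> l = a \<and> k \<le> s)"

lemma realized_edge_adjacent:
  assumes i: "1 \<le> i" "i < n" "i \<noteq> s"
  shows "realized n (block_circle s) (\<lambda>k l. c * edge i (i + 1) k l)"
proof -
  have "realized n (block_circle s) (\<lambda>k l. (if e then 1 else - 1) * edge i (i + 1) k l)" for e
  proof -
    let ?w = "[(i, e), (i, e)]"
    have w: "?w \<in> braid_words n"
      using i by (simp add: braid_words_Cons Nil_in_braid_words)
    show ?thesis
      unfolding realized_def
    proof (intro bexI[OF _ w] conjI exI[of _ "word_homeo ?w"] ballI)
      show "isotopic n (word_homeo ?w) (word_homeo ?w)"
        by (rule isotopic_refl[OF disk_homeo_word_homeo[OF w]])
      show "word_crossing ?w k l = (if e then 1 else - 1) * edge i (i + 1) k l" for k l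
        by (auto simp: edge_def Transposition.transpose_def)
      show "word_homeo ?w z = z" if "z \<in> block_circle s" for z
        using half_twist_fixes_block_circle[OF i(1,3) that] by simp
    qed simp
  qed
  from realized_scale[of n _ "edge i (i + 1)"] this[of True] this[of False] show ?thesis by simp
qed

text \<open>
  Conjugation by the letters other than \<open>s\<close>, which fix the circle, carries the pair of adjacent strands
  to any other pair on the same side.
\<close>

lemma realized_edge:
  assumes "1 \<le> a" "a < b" "b \<le> n" "b \<le> s \<or> s < a"
  shows "realized n (block_circle s) (\<lambda>k l. c * edge a b k l)"
  using assms(2-4)
proof (induction b)
  case (Suc b)
  show ?case
  proof (cases "a = b")
    case True
    moreover have "a \<noteq> s" using Suc.prems by auto
    ultimately show ?thesis
      using realized_edge_adjacent[of a n s c] Suc.prems assms(1) by simp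
  next
    case False
    have IH: "realized n (block_circle s) (\<lambda>k l. c * edge a b k l)"
      by (rule Suc.IH) (use Suc.prems False in auto)
    have "edge a b (Transposition.transpose b (b + 1) k) (Transposition.transpose b (b + 1) l)
        = edge a (Suc b) k l" for k l
      using False Suc.prems by (auto simp: edge_def Transposition.transpose_def)
    moreover have "b \<noteq> s" using Suc.prems False by auto
    ultimately show ?thesis
      using realized_permute[OF IH, of b] Suc.prems False assms(1) by simp
  qed
qed simp

lemma word_crossing_sweep:
  assumes "1 \<le> k" "1 \<le> l"
  shows "word_crossing (sweep m e) k l
    = (if e then of_bool (k = m + 1 \<and> l \<le> m) else - of_bool (l = m + 1 \<and> k \<le> m))"
  using assms
proof (induction m arbitrary: k l)
  case (Suc m)
  have "1 \<le> Transposition.transpose (Suc m) (Suc m + 1) k" "1 \<le> Transposition.transpose (Suc m) (Suc m + 1) l"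
    using Suc.prems by (auto simp: Transposition.transpose_def)
  from Suc.IH[OF this] Suc.prems show ?case
    by (cases e) (auto simp: Transposition.transpose_def)
qed auto

lemma word_crossing_loop_around:
  assumes "1 \<le> k" "1 \<le> l"
  shows "word_crossing (loop_around s e) k l = (if e then 1 else - 1) * star s (s + 1) k l"
proof -
  have "end_position (sweep s e) j = end_position (sweep s (\<not> e)) j" if "1 \<le> j" for j
    by (simp only: end_position_sweep[OF that])
  with assms have "word_crossing (loop_around s e) k l
      = word_crossing (sweep s e) k l - word_crossing (sweep s (\<not> e)) k l"
    by (simp add: loop_around_def word_crossing_append word_crossing_inverse)
  also have "\<dots> = (if e then 1 else - 1) * star s (s + 1) k l"
    using assms by (cases e) (auto simp: word_crossing_sweep star_def)
  finally show ?thesis .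
qed

lemma realized_star_adjacent:
  assumes s: "1 \<le> s" "s < n"
  shows "realized n (block_circle s) (\<lambda>k l. c * star s (s + 1) k l)"
proof -
  have "realized n (block_circle s) (\<lambda>k l. (if e then 1 else - 1) * star s (s + 1) k l)" for e
    unfolding realized_def
  proof (intro bexI[OF _ loop_around_in[OF s(2)]] conjI ballI
      exI[of _ "orbit_motion s (turn_sign e * 2 * pi)"])
    show "isotopic n (word_homeo (loop_around s e)) (orbit_motion s (turn_sign e * 2 * pi))"
      by (rule loop_around_isotopic[OF s])
    show "orbit_motion s (turn_sign e * 2 * pi) z = z" if "z \<in> block_circle s" for z
      by (rule orbit_motion_full_turn[OF that]) (simp add: turn_sign_def complex_eq_iff)
    show "end_position (loop_around s e) k = k" if "k \<in> {1..n}" for k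
      using that by (intro end_position_loop_around) auto
    show "word_crossing (loop_around s e) k l = (if e then 1 else - 1) * star s (s + 1) k l"
      if "k \<in> {1..n}" "l \<in> {1..n}" for k l
      using that by (intro word_crossing_loop_around) auto
  qed
  from realized_scale[of n _ "star s (s + 1)"] this[of True] this[of False] show ?thesis by simp
qed

lemma realized_star:
  assumes "1 \<le> s" "s < a" "a \<le> n"
  shows "realized n (block_circle s) (\<lambda>k l. c * star s a k l)"
  using assms(2,3)
proof (induction a)
  case (Suc a)
  show ?case
  proof (cases "a = s")
    case True
    with realized_star_adjacent[of s n c] Suc.prems assms(1) show ?thesis by simp
  next
    case False
    with Suc have IH: "realized n (block_circle s) (\<lambda>k l. c * star s a k l)" by simp
    have "star s a (Transposition.transpose a (a + 1) k) (Transposition.transpose a (a + 1) l)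
        = star s (Suc a) k l" for k l
      using False Suc.prems by (auto simp: star_def Transposition.transpose_def)
    with realized_permute[OF IH, of a] Suc.prems False assms(1) show ?thesis by simp
  qed
qed simp

text \<open>
  The pairs on the same side of the circle contribute one \<open>edge\<close> matrix each. The pairs with one
  strand in the block are grouped into one \<open>star\<close> matrix for each strand \<open>a\<close> outside; its coefficient
  \<open>A a 1\<close> is the common value of the row \<open>a\<close> on the block.
\<close>

lemma realized_initial_block:
  assumes s: "1 \<le> s" "s < n"
    and diag: "\<And>i. i \<in> {1..n} \<Longrightarrow> A i i = 0"
    and sym: "\<And>i j. i \<in> {1..n} \<Longrightarrow> j \<in> {1..n} \<Longrightarrow> A i j = A j i"
    and const: "\<And>i j j'. i \<in> {1..n} - {1..s} \<Longrightarrow> j \<in> {1..s} \<Longrightarrow> j' \<in> {1..s} \<Longrightarrow> A i j = A i j'"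
  shows "realized n (block_circle s) A"
proof -
  define I where "I = {(a, b). 1 \<le> a \<and> a < b \<and> b \<le> n \<and> (b \<le> s \<or> s < a)}"
  have "finite I"
    by (rule finite_subset[of _ "{1..n} \<times> {1..n}"]) (auto simp: I_def)
  have "realized n (block_circle s)
      (\<lambda>k l. (\<Sum>p\<in>I. A (fst p) (snd p) * edge (fst p) (snd p) k l) + (\<Sum>a\<in>{s + 1..n}. A a 1 * star s a k l))"
    using \<open>finite I\<close> s
    by (intro realized_add realized_sum realized_edge realized_star) (auto simp: I_def)
  moreover have "(\<Sum>p\<in>I. A (fst p) (snd p) * edge (fst p) (snd p) k l)
      + (\<Sum>a\<in>{s + 1..n}. A a 1 * star s a k l) = A k l" if kl: "k \<in> {1..n}" "l \<in> {1..n}" for k l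
  proof -
    define m M where "m = min k l" and "M = max k l"
    have mM: "1 \<le> m" "m \<le> M" "M \<le> n" "A m M = A k l" "A M m = A k l"
      using kl sym[of k l] by (auto simp: m_def M_def min_def max_def)
    have "(\<Sum>p\<in>I. A (fst p) (snd p) * edge (fst p) (snd p) k l)
        = (\<Sum>p\<in>I. if p = (m, M) then A k l else 0)"
      using mM(4) by (intro sum.cong) (auto simp: edge_def I_def m_def M_def)
    also have "\<dots> = (if (m, M) \<in> I then A k l else 0)"
      using \<open>finite I\<close> by simp
    finally have edges: "(\<Sum>p\<in>I. A (fst p) (snd p) * edge (fst p) (snd p) k l) = \<dots>" .
    have "(\<Sum>a\<in>{s + 1..n}. A a 1 * star s a k l)
        = (\<Sum>a\<in>{s + 1..n}. if a = M then (if m \<le> s then A M 1 else 0) else 0)"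
      by (intro sum.cong) (auto simp: star_def m_def M_def)
    also have "\<dots> = (if m \<le> s \<and> s < M then A M 1 else 0)"
      using mM by simp
    finally have stars: "(\<Sum>a\<in>{s + 1..n}. A a 1 * star s a k l) = \<dots>" .
    have "A M 1 = A k l" if "m \<le> s" "s < M"
      using const[of M 1 m] mM that s by simp
    moreover have "A k l = 0" if "m = M"
      using that diag[of k] kl by (simp add: m_def M_def min_def max_def split: if_splits)
    ultimately show ?thesis
      unfolding edges stars using mM by (auto simp: I_def)
  qed
  ultimately show ?thesis
    by (subst (asm) realized_cong[where B = A]) auto
qed

text \<open>
  As long as \<open>S\<close> is not an initial segment, some \<open>i + 1 \<in> S\<close> has \<open>i \<notin> S\<close>; conjugating by the generator
  that exchanges the two positions decreases the sum of \<open>S\<close>.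
\<close>

lemma realized_block:
  assumes "S \<subseteq> {1..n}" "card S = s" "1 \<le> s" "s < n"
    and "\<And>i. i \<in> {1..n} \<Longrightarrow> A i i = 0"
    and "\<And>i j. i \<in> {1..n} \<Longrightarrow> j \<in> {1..n} \<Longrightarrow> A i j = A j i"
    and "\<And>i j j'. i \<in> {1..n} - S \<Longrightarrow> j \<in> S \<Longrightarrow> j' \<in> S \<Longrightarrow> A i j = A i j'"
  shows "\<exists>u\<in>braid_words n. realized n (word_homeo u ` block_circle s) A"
  using assms
proof (induction "\<Sum>S" arbitrary: S A rule: less_induct)
  case less
  have fin: "finite S" using less.prems(1) finite_subset by blast
  show ?case
  proof (cases "\<exists>i. 1 \<le> i \<and> i \<notin> S \<and> i + 1 \<in> S")
    case False
    define m where "m = Max S"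
    have "S \<noteq> {}" using less.prems(2,3) by auto
    then have m: "m \<in> S" "S \<subseteq> {1..m}" using fin less.prems(1) by (auto simp: m_def)
    have "j \<in> S" if "1 \<le> j" "j \<le> m" for j
      using that(2,1) m(1) False by (induction rule: inc_induct) auto
    then have "S = {1..m}" using m by auto
    then have "S = {1..s}" using less.prems(2) by simp
    then have "realized n (block_circle s) A"
      using less.prems(3-) by (intro realized_initial_block) blast+
    then show ?thesis
      by (intro bexI[OF _ Nil_in_braid_words]) (simp add: image_image)
  next
    case True
    then obtain i where i: "1 \<le> i" "i \<notin> S" "i + 1 \<in> S" by blast
    have "i < n" using i less.prems(1) by auto
    let ?t = "Transposition.transpose i (i + 1)"
    have t: "?t k \<in> {1..n} \<longleftrightarrow> k \<in> {1..n}" for k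
      using i(1) \<open>i < n\<close> by (auto simp: Transposition.transpose_def)
    have t_mem: "k \<in> ?t ` S \<longleftrightarrow> ?t k \<in> S" for k
      by (metis (no_types, lifting) image_iff transpose_involutory)
    have "?t ` S = insert i (S - {i + 1})"
      unfolding set_eq_iff t_mem using i by (auto simp: Transposition.transpose_def)
    moreover have "\<Sum>(insert i (S - {i + 1})) < \<Sum>S"
      using i fin sum.remove[OF fin i(3), of "\<lambda>x. x"] by simp
    ultimately have "\<Sum>(?t ` S) < \<Sum>S" by simp
    moreover have "?t ` S \<subseteq> {1..n}" using less.prems(1) t by blast
    moreover have "card (?t ` S) = s" using less.prems(2) by (simp add: card_image)
    ultimately have "\<exists>u\<in>braid_words n. realized n (word_homeo u ` block_circle s) (\<lambda>k l. A (?t k) (?t l))"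
    proof (rule less.hyps[OF _ _ _ less.prems(3,4)])
      show "A (?t k) (?t k) = 0" if "k \<in> {1..n}" for k
        using less.prems(5) t that by blast
      show "A (?t k) (?t l) = A (?t l) (?t k)" if "k \<in> {1..n}" "l \<in> {1..n}" for k l
        using less.prems(6) t that by blast
      show "A (?t k) (?t j) = A (?t k) (?t j')"
        if "k \<in> {1..n} - ?t ` S" "j \<in> ?t ` S" "j' \<in> ?t ` S" for k j j'
        using that unfolding t_mem Diff_iff by (intro less.prems(7)) (simp_all only: t Diff_iff simp_thms)
    qed
    then obtain u where u: "u \<in> braid_words n"
      "realized n (word_homeo u ` block_circle s) (\<lambda>k l. A (?t k) (?t l))" by blast
    have "realized n (word_homeo (u @ [(i, False)]) ` block_circle s) A"
      using realized_conjugate[OF u(2) i(1) \<open>i < n\<close>]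
      by (simp add: image_image word_homeo_append)
    moreover have "u @ [(i, False)] \<in> braid_words n"
      using u(1) i(1) \<open>i < n\<close> by (simp add: braid_words_append braid_words_Cons Nil_in_braid_words)
    ultimately show ?thesis by blast
  qed
qed


section \<open>Insides of curves under homeomorphisms of the disk\<close>

text \<open>
  Extended by the identity, a homeomorphism of the disk that fixes the boundary becomes one of the
  plane, which permutes the components of complements of curves and keeps bounded ones bounded. This
  also works for curves that touch the boundary of the disk.
\<close>

lemma disk_auto_extend:
  assumes f: "disk_auto n f"
  shows "\<exists>h k. homeomorphism UNIV UNIV h k \<and> (\<forall>z\<in>disk n. h z = f z)"
proof -
  define ext where "ext f z = (if z \<in> disk n then f z else z)" for f :: "complex \<Rightarrow> complex" and z
  have cont: "continuous_on UNIV (ext f)" if "disk_auto n f" for f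
  proof -
    have "continuous_on (disk n \<union> closure (- disk n)) (\<lambda>z. if z \<in> disk n then f z else z)"
    proof (rule continuous_on_cases)
      show "closed (disk n)" by (simp add: compact_imp_closed compact_disk)
      show "continuous_on (disk n) f" using that by (simp add: disk_auto_def)
      have "z \<in> frontier (disk n)" if "z \<in> closure (- disk n)" "z \<in> disk n" for z
        using that closure_subset[of "disk n"] by (auto simp: frontier_closures)
      then show "\<forall>z. z \<in> disk n \<and> z \<notin> disk n \<or> z \<in> closure (- disk n) \<and> z \<in> disk n \<longrightarrow> f z = z"
        using that by (auto simp: disk_auto_def)
    qed auto
    moreover have "disk n \<union> closure (- disk n) = UNIV"
      using closure_subset[of "- disk n"] by blast
    ultimately show ?thesis by (simp add: ext_def[abs_def])
  qed
  define g where "g = inv_into (disk n) f"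
  have bij: "bij_betw f (disk n) (disk n)" using f by (simp add: disk_auto_def)
  have gf: "g (f z) = z" and fg: "f (g z) = z" and g_in: "g z \<in> disk n" if "z \<in> disk n" for z
    using that bij unfolding g_def
    by (auto simp: bij_betw_inv_into_left bij_betw_inv_into_right intro: bij_betw_apply bij_betw_inv_into)
  have "disk_auto n g"
    unfolding disk_auto_def
  proof (intro conjI ballI)
    show "continuous_on (disk n) g"
      using continuous_on_inv[of "disk n" f g] f gf compact_disk bij
      by (simp add: disk_auto_def bij_betw_def)
    show "bij_betw g (disk n) (disk n)"
      unfolding g_def by (rule bij_betw_inv_into[OF bij])
    show "g z = z" if "z \<in> frontier (disk n)" for z
    proof -
      have "f z = z" using f that by (simp add: disk_auto_def)
      then show ?thesis using gf[of z] that frontier_disk_subset by auto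
    qed
  qed
  have "homeomorphism UNIV UNIV (ext f) (ext g)"
    unfolding homeomorphism_def
    using cont[OF f] cont[OF \<open>disk_auto n g\<close>] gf fg g_in disk_auto_in_disk[OF f]
    by (auto simp: ext_def image_iff) (metis+)
  then show ?thesis
    by (intro exI[of _ "ext f"] exI[of _ "ext g"]) (simp add: ext_def)
qed

lemma inside_homeomorphism_subset:
  fixes h :: "complex \<Rightarrow> complex"
  assumes h: "homeomorphism UNIV UNIV h k"
  shows "h ` inside C \<subseteq> inside (h ` C)"
proof
  fix y assume "y \<in> h ` inside C"
  then obtain x where x: "y = h x" "x \<notin> C" "bounded (connected_component_set (- C) x)"
    by (auto simp: inside_def)
  have kh: "k (h z) = z" and hk: "h (k z) = z" for z
    using h by (auto simp: homeomorphism_def)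
  have cont: "continuous_on UNIV h" using h by (simp add: homeomorphism_def)
  have "h ` (- C) = - h ` C"
    by (auto simp: image_iff) (metis kh, metis hk ComplI)
  then have "homeomorphism (- C) (- h ` C) h k"
    using homeomorphism_of_subsets[OF h, of "- C" UNIV] by simp
  from connected_component_set_homeomorphism[OF this] x
  have "connected_component_set (- h ` C) y = h ` connected_component_set (- C) x" by simp
  moreover have "bounded (h ` connected_component_set (- C) x)"
  proof (rule bounded_subset)
    show "bounded (h ` closure (connected_component_set (- C) x))"
      using x(3) continuous_on_subset[OF cont]
      by (intro compact_imp_bounded compact_continuous_image) auto
  qed (use closure_subset in blast)
  moreover have "y \<notin> h ` C" using x kh by (metis imageE)
  ultimately show "y \<in> inside (h ` C)" by (simp add: inside_def)
qed

lemma inside_subset_disk: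
  assumes "C \<subseteq> disk n" shows "inside C \<subseteq> disk n"
  using inside_mono[OF assms] inside_convex[OF convex_disk, of n] by auto

lemma inside_disk_auto:
  assumes f: "disk_auto n f" and C: "C \<subseteq> disk n"
  shows "inside (f ` C) = f ` inside C"
proof -
  obtain h k where h: "homeomorphism UNIV UNIV h k" "\<And>z. z \<in> disk n \<Longrightarrow> h z = f z"
    using disk_auto_extend[OF f] by blast
  have kh: "k (h z) = z" and hk: "h (k z) = z" for z
    using h(1) by (auto simp: homeomorphism_def)
  have "f ` C = h ` C" "f ` inside C = h ` inside C"
    using h(2) C inside_subset_disk[OF C] by (auto intro!: image_cong)
  moreover have "inside (h ` C) \<subseteq> h ` inside C"
  proof -
    have "k ` inside (h ` C) \<subseteq> inside (k ` h ` C)"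
      by (rule inside_homeomorphism_subset[OF homeomorphism_symD[OF h(1)]])
    then have "h ` k ` inside (h ` C) \<subseteq> h ` inside C"
      by (intro image_mono) (simp add: image_image kh)
    then show ?thesis by (simp add: image_image hk)
  qed
  ultimately show ?thesis
    using inside_homeomorphism_subset[OF h(1), of C] by auto
qed

lemma inside_block_circle: "inside (block_circle s) = ball (block_centre s) (real s / 2)"
proof (cases "s = 0")
  case True
  then show ?thesis by (simp add: block_circle_def)
next
  case False
  have "inside (frontier (cball (block_centre s) (real s / 2))) = interior (cball (block_centre s) (real s / 2))"
    by (rule inside_frontier_eq_interior) auto
  with False show ?thesis by (simp add: block_circle_def)
qed

lemma essential_curve_block_circle:
  assumes "2 \<le> s" "s < n"
  shows "essential_curve n (block_circle s)"
  unfolding essential_curve_def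
proof (intro conjI exI[of _ "circlepath (block_centre s) (real s / 2)"])
  show "simple_path (circlepath (block_centre s) (real s / 2))"
    using assms by (simp add: simple_path_circlepath)
  show "path_image (circlepath (block_centre s) (real s / 2)) = block_circle s"
    by (simp add: block_circle_def)
  have "cball (block_centre s) (real s / 2) \<subseteq> disk n"
    by (rule cball_subset_disk[OF block_centre_def]) (use assms in \<open>simp_all add: field_simps\<close>)
  moreover have "of_nat k \<notin> block_circle s" for k
  proof
    assume "of_nat k \<in> block_circle s"
    then have "\<bar>real k - (real s + 1) / 2\<bar> = real s / 2"
      using cmod_block_centre[of k s] by (simp add: block_circle_def dist_norm norm_minus_commute)
    then have "real (2 * k) = real (2 * s + 1) \<or> real (2 * k) = real 1"
      by (auto simp: abs_if field_simps split: if_splits)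
    then have "2 * k = 2 * s + 1 \<or> 2 * k = 1" by (simp only: of_nat_eq_iff)
    then show False by presburger
  qed
  ultimately show "block_circle s \<subseteq> disk n - punctures n"
    by (auto simp: punctures_def block_circle_def)
  have "of_nat k \<in> ball (block_centre s) (real s / 2) \<longleftrightarrow> k \<in> {1..s}" for k
  proof -
    have "of_nat k \<in> ball (block_centre s) (real s / 2) \<longleftrightarrow> \<bar>real k - (real s + 1) / 2\<bar> < real s / 2"
      using cmod_block_centre[of k s] by (simp add: dist_norm norm_minus_commute)
    also have "\<dots> \<longleftrightarrow> real 1 < real (2 * k) \<and> real (2 * k) < real (2 * s + 1)"
      unfolding abs_less_iff by (auto simp: field_simps)
    also have "\<dots> \<longleftrightarrow> k \<in> {1..s}" unfolding of_nat_less_iff by auto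
    finally show ?thesis .
  qed
  then have "{k \<in> {1..n}. of_nat k \<in> ball (block_centre s) (real s / 2)} = {1..n} \<inter> {1..s}"
    by (simp only: Int_def)
  moreover have "inside (block_circle s) \<inter> punctures n
      = of_nat ` {k \<in> {1..n}. of_nat k \<in> ball (block_centre s) (real s / 2)}"
    unfolding inside_block_circle punctures_def by blast
  moreover have "{1..n} \<inter> {1..s} = {1..s}" using assms(2) by auto
  ultimately have "inside (block_circle s) \<inter> punctures n = of_nat ` {1..s}"
    by (simp only:)
  then have "card (inside (block_circle s) \<inter> punctures n) = s"
    by (simp add: card_image inj_on_def)
  then show "card (inside (block_circle s) \<inter> punctures n) \<in> {2..n - 1}"
    using assms by auto
qed auto

lemma essential_curve_disk_homeo:
  assumes f: "disk_homeo n f" and C: "essential_curve n C"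
  shows "essential_curve n (f ` C)"
proof -
  obtain \<gamma> where \<gamma>: "simple_path \<gamma>" "pathfinish \<gamma> = pathstart \<gamma>" "path_image \<gamma> = C"
    and C_sub: "C \<subseteq> disk n - punctures n" and card: "card (inside C \<inter> punctures n) \<in> {2..n - 1}"
    using C by (auto simp: essential_curve_def)
  have auto: "disk_auto n f" and punct: "f ` punctures n = punctures n"
    using f by (auto simp: disk_homeo_iff)
  have inj: "inj_on f (disk n)" and cont: "continuous_on (disk n) f" and onto: "f ` disk n = disk n"
    using auto by (auto simp: disk_auto_def bij_betw_def)
  have C_disk: "C \<subseteq> disk n" using C_sub by blast
  show ?thesis
    unfolding essential_curve_def
  proof (intro conjI exI[of _ "f \<circ> \<gamma>"])
    show "simple_path (f \<circ> \<gamma>)"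
      using \<gamma> C_disk cont inj
      by (intro simple_path_continuous_image) (auto intro: continuous_on_subset inj_on_subset)
    show "f ` C \<subseteq> disk n - punctures n"
      using inj_on_image_set_diff[OF inj, of "disk n" "punctures n"] punctures_subset[of n] C_sub onto punct
      by auto
    have "inside (f ` C) \<inter> punctures n = f ` (inside C \<inter> punctures n)"
      using inj_on_image_Int[OF inj inside_subset_disk[OF C_disk] punctures_subset]
      by (simp add: inside_disk_auto[OF auto C_disk] punct)
    moreover have "inj_on f (inside C \<inter> punctures n)"
      using inj punctures_subset by (auto intro: inj_on_subset)
    ultimately show "card (inside (f ` C) \<inter> punctures n) \<in> {2..n - 1}"
      using card by (simp add: card_image)
  qed (use \<gamma> in \<open>auto simp: path_image_compose pathfinish_compose pathstart_compose\<close>)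
qed

lemma reducible_if_realized:
  assumes C: "essential_curve n C" and A: "realized n C A"
  shows "\<exists>b\<in>braid_group n. pure_braid n b \<and> reducible_braid n b \<and>
    (\<forall>i\<in>{1..n}. \<forall>j\<in>{1..n}. A i j = crossing_matrix b i j)"
proof -
  obtain w g where w: "w \<in> braid_words n" "\<forall>k\<in>{1..n}. end_position w k = k"
    "\<forall>k\<in>{1..n}. \<forall>l\<in>{1..n}. word_crossing w k l = A k l"
    "isotopic n (word_homeo w) g" "\<forall>z\<in>C. g z = z"
    using A by (auto simp: realized_def)
  define b where "b = braid_rel n `` {w}"
  have b: "b \<in> braid_group n" unfolding b_def braid_group_def by (rule quotientI[OF w(1)])
  have wb: "w \<in> b" unfolding b_def using equiv_class_self[OF equiv_braid_rel w(1)] .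
  have "pure_braid n b"
    using w(2) braid_rel_end_position unfolding pure_braid_def b_def by (metis Image_singleton_iff)
  moreover have "reducible_braid n b"
    unfolding reducible_braid_def
  proof (intro exI[of _ "{C}"] conjI bexI[of _ g])
    show "g \<in> mapping_class n b"
      using wb w(4) by (auto simp: mapping_class_def)
    show "(`) g ` {C} = {C}" using w(5) by force
  qed (use C in \<open>auto simp: pairwise_def\<close>)
  ultimately show ?thesis
    using b wb w(3) crossing_matrix_eq by (metis (no_types, lifting))
qed


section \<open>The angle swept by a pair of points\<close>

lemma exp_lift_unique:
  fixes p q :: "'a::topological_space \<Rightarrow> complex"
  assumes "connected U" "continuous_on U p" "continuous_on U q"
    and "\<And>x. x \<in> U \<Longrightarrow> exp (p x) = exp (q x)" "a \<in> U" "p a = q a" "x \<in> U"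
  shows "p x = q x"
  by (rule covering_space_lift_unique[OF covering_space_exp_punctured_plane, where T = U and a = a
        and f = "\<lambda>x. exp (p x)"])
    (use assms in \<open>auto intro!: continuous_intros\<close>)

lemma exp_lift_homotopy:
  fixes F :: "real \<Rightarrow> complex \<Rightarrow> complex"
  assumes F: "continuous_on ({0..1} \<times> U) (\<lambda>(t, z). F t z)"
    and nz: "\<And>t z. t \<in> {0..1} \<Longrightarrow> z \<in> U \<Longrightarrow> F t z \<noteq> 0"
    and L: "continuous_on U L" "\<And>z. z \<in> U \<Longrightarrow> exp (L z) = F 0 z"
  obtains M where "continuous_on ({0..1} \<times> U) (\<lambda>(t, z). M t z)" "\<And>z. z \<in> U \<Longrightarrow> M 0 z = L z"
    "\<And>t z. t \<in> {0..1} \<Longrightarrow> z \<in> U \<Longrightarrow> exp (M t z) = F t z"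
proof -
  obtain k where "continuous_on ({0..1} \<times> U) k" "\<And>z. z \<in> U \<Longrightarrow> k (0, z) = L z"
    "\<And>p. p \<in> {0..1} \<times> U \<Longrightarrow> (case p of (t, z) \<Rightarrow> F t z) = exp (k p)"
    using covering_space_lift_homotopy[OF covering_space_exp_punctured_plane F _ _ L(1)] nz L(2)
    by (auto simp: Pi_iff)
  then show ?thesis by (intro that[of "\<lambda>t z. k (t, z)"]) auto
qed

lemma continuous_on_slice:
  assumes "continuous_on ({0..1::real} \<times> U) (\<lambda>(t, z). M t z)"
  shows "z \<in> U \<Longrightarrow> continuous_on {0..1} (\<lambda>t. M t z)" "t \<in> {0..1} \<Longrightarrow> continuous_on U (M t)"
proof -
  show "continuous_on {0..1} (\<lambda>t. M t z)" if "z \<in> U"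
  proof -
    have "continuous_on {0..1} (\<lambda>t. (t, z))" by (intro continuous_intros)
    from continuous_on_compose2[OF assms this] that show ?thesis by auto
  qed
  show "continuous_on U (M t)" if "t \<in> {0..1}"
  proof -
    have "continuous_on U (\<lambda>z. (t, z))" by (intro continuous_intros)
    from continuous_on_compose2[OF assms this] that show ?thesis by (simp add: image_subset_iff)
  qed
qed

lemma letter_motion_inj: "letter_motion x t z = letter_motion x t w \<longleftrightarrow> z = w"
  unfolding letter_motion_def by (metis twist_twist twist_0 add.left_inverse)

lemma Re_letter_motion:
  "k \<noteq> i \<Longrightarrow> k \<noteq> i + 1 \<Longrightarrow> Re (letter_motion (i, e) t (of_nat k)) = real k"
  "k = i \<or> k = i + 1 \<Longrightarrow> real i \<le> Re (letter_motion (i, e) t (of_nat k))"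
  "k = i \<or> k = i + 1 \<Longrightarrow> Re (letter_motion (i, e) t (of_nat k)) \<le> real i + 1"
proof -
  show "k \<noteq> i \<Longrightarrow> k \<noteq> i + 1 \<Longrightarrow> Re (letter_motion (i, e) t (of_nat k)) = real k"
    by (simp add: letter_motion_far)
  assume k: "k = i \<or> k = i + 1"
  define c where "c = cos ((if e then - pi else pi) * max 0 (min 1 t))"
  have "\<bar>c\<bar> \<le> 1" unfolding c_def by (rule abs_cos_le_one)
  moreover have "Re (letter_motion (i, e) t (of_nat k)) = real i + 1 / 2 + (if k = i then - 1 / 2 else 1 / 2) * c"
    unfolding c_def by (subst letter_motion_near[OF k]) simp
  ultimately show "real i \<le> Re (letter_motion (i, e) t (of_nat k))"
    "Re (letter_motion (i, e) t (of_nat k)) \<le> real i + 1"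
    by (auto simp: abs_le_iff split: if_splits)
qed

lemma Re_letter_motion_less:
  assumes "a < b" "\<not> (a = i \<and> b = i + 1)"
  shows "Re (letter_motion (i, e) t (of_nat a)) < Re (letter_motion (i, e) t (of_nat b))"
proof (cases "a = i \<or> a = i + 1")
  case True
  with assms have "i + 1 < b" by auto
  then show ?thesis
    using Re_letter_motion(3)[OF True, of e t] Re_letter_motion(1)[of b i e t] by simp
next
  case a: False
  show ?thesis
  proof (cases "b = i \<or> b = i + 1")
    case True
    with a assms have "a < i" by auto
    then show ?thesis
      using Re_letter_motion(2)[OF True, of e t] Re_letter_motion(1)[of a i e t] a by simp
  next
    case False
    with a assms show ?thesis by (simp add: Re_letter_motion(1))
  qed
qed

text \<open>
  The logarithm is obtained by lifting the homotopy from \<open>1\<close> that the letter motion provides, starting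
  with the logarithm \<open>0\<close>. Its value at \<open>q\<close> follows the path of \<open>q\<close> as seen from \<open>p\<close>: if the letter
  exchanges \<open>p\<close> and \<open>q\<close>, this is a half turn, and otherwise the direction stays in the right half plane
  relative to its start, where the lift is the principal logarithm.
\<close>

lemma letter_angle_lift:
  "\<exists>L. continuous_on (- {of_nat p}) L \<and>
    (\<forall>z. z \<noteq> of_nat p \<longrightarrow> exp (L z) = (half_twist x z - half_twist x (of_nat p)) / (z - of_nat p)) \<and>
    (\<forall>q. q \<noteq> p \<longrightarrow> Im (L (of_nat q)) = - pi * of_int (word_crossing [x] p q + word_crossing [x] q p))"
proof -
  obtain i e where x: "x = (i, e)" by fastforce
  define F where "F t z = (letter_motion x t z - letter_motion x t (of_nat p)) / (z - of_nat p)" for t z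
  have cont: "continuous_on ({0..1} \<times> - {of_nat p}) (\<lambda>(t, z). F t z)"
    unfolding F_def letter_motion_def case_prod_beta by (intro continuous_intros) auto
  have nz: "F t z \<noteq> 0" if "z \<in> - {of_nat p}" for t z
    using that by (simp add: F_def letter_motion_inj)
  have F0: "F 0 z = 1" if "z \<in> - {of_nat p}" for z
    using that by (simp add: F_def letter_motion_start)
  obtain M where M: "continuous_on ({0..1} \<times> - {of_nat p}) (\<lambda>(t, z). M t z)"
    "\<And>z. z \<in> - {of_nat p} \<Longrightarrow> M 0 z = 0"
    "\<And>t z. t \<in> {0..1} \<Longrightarrow> z \<in> - {of_nat p} \<Longrightarrow> exp (M t z) = F t z"
    using exp_lift_homotopy[OF cont nz, of "\<lambda>_. 0"] F0 by auto
  have "Im (M 1 (of_nat q)) = - pi * of_int (word_crossing [x] p q + word_crossing [x] q p)"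
    if q: "q \<noteq> p" for q
  proof -
    have q': "of_nat q \<in> - {of_nat p :: complex}" using q by simp
    note path = continuous_on_slice(1)[OF M(1) q']
    show ?thesis
    proof (cases "{p, q} = {i, i + 1}")
      case True
      then have pq: "p = i \<and> q = i + 1 \<or> p = i + 1 \<and> q = i"
        by (auto simp: doubleton_eq_iff)
      define \<theta> where "\<theta> = (if e then - pi else pi)"
      have "M 1 (of_nat q) = \<i> * of_real (\<theta> * 1)"
      proof (rule exp_lift_unique[of "{0..1::real}" "\<lambda>t. M t (of_nat q)" "\<lambda>t. \<i> * of_real (\<theta> * t)" 0])
        show "exp (M t (of_nat q)) = exp (\<i> * of_real (\<theta> * t))" if t: "t \<in> {0..1}" for t
        proof -
          have clamp: "max 0 (min 1 t) = t" using t by auto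
          have "F t (of_nat q) = cis (\<theta> * t)"
            using pq
          proof (elim disjE conjE)
            assume pq: "p = i" "q = i + 1"
            show ?thesis
              unfolding F_def x pq
              by (subst (1 2) letter_motion_near) (simp_all only: clamp, simp_all add: \<theta>_def)
          next
            assume pq: "p = i + 1" "q = i"
            show ?thesis
              unfolding F_def x pq
              by (subst (1 2) letter_motion_near) (simp_all only: clamp, simp_all add: \<theta>_def)
          qed
          then show ?thesis using M(3)[OF t q'] by (simp add: cis_conv_exp)
        qed
      qed (use path M(2)[OF q'] in \<open>auto intro!: continuous_intros\<close>)
      then show ?thesis using pq by (auto simp: x \<theta>_def)
    next
      case False
      have pos: "0 < Re (F t (of_nat q))" for t
      proof -
        have "F t (of_nat q) = (letter_motion x t (of_nat q) - letter_motion x t (of_nat p)) / of_real (real q - real p)"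
          by (simp add: F_def)
        then have Re: "Re (F t (of_nat q))
            = (Re (letter_motion x t (of_nat q)) - Re (letter_motion x t (of_nat p))) / (real q - real p)"
          by (simp only: Re_divide_of_real minus_complex.sel)
        show ?thesis
        proof (cases "p < q")
          case True
          moreover have "\<not> (p = i \<and> q = i + 1)" using False by auto
          ultimately show ?thesis
            using Re_letter_motion_less[of p q i e t] unfolding Re x by (intro divide_pos_pos) auto
        next
          case False
          with q have "q < p" by simp
          moreover have "\<not> (q = i \<and> p = i + 1)" using \<open>{p, q} \<noteq> {i, i + 1}\<close> by auto
          ultimately show ?thesis
            using Re_letter_motion_less[of q p i e t] unfolding Re x by (intro divide_neg_neg) auto
        qed
      qed
      then have notin: "F t (of_nat q) \<notin> \<real>\<^sub>\<le>\<^sub>0" for t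
        by (metis complex_nonpos_Reals_iff not_le)
      have "M 1 (of_nat q) = Ln (F 1 (of_nat q))"
      proof (rule exp_lift_unique[of "{0..1::real}" "\<lambda>t. M t (of_nat q)" "\<lambda>t. Ln (F t (of_nat q))" 0])
        show "continuous_on {0..1} (\<lambda>t. Ln (F t (of_nat q)))"
          using notin by (intro continuous_intros continuous_on_slice(1)[OF cont q']) auto
        show "exp (M t (of_nat q)) = exp (Ln (F t (of_nat q)))" if "t \<in> {0..1}" for t
          using M(3)[OF that q'] nz[OF q'] by simp
        show "M 0 (of_nat q) = Ln (F 0 (of_nat q))"
          using M(2)[OF q'] F0[OF q'] by simp
      qed (use path in auto)
      moreover have "F 1 (of_nat q) = of_real (Re (F 1 (of_nat q)))"
      proof -
        have "F 1 (of_nat q) = of_real ((real (Transposition.transpose i (i + 1) q) - real (Transposition.transpose i (i + 1) p)) / (real q - real p))"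
          by (simp add: F_def x half_twist_eq[symmetric] half_twist_of_nat)
        then show ?thesis by (metis Re_complex_of_real)
      qed
      ultimately have "M 1 (of_nat q) = of_real (ln (Re (F 1 (of_nat q))))"
        using Ln_of_real[OF pos[of 1]] by metis
      then have "Im (M 1 (of_nat q)) = 0" by simp
      moreover have "word_crossing [x] p q + word_crossing [x] q p = 0"
        using False by (auto simp: x)
      ultimately show ?thesis by simp
    qed
  qed
  then show ?thesis
    using continuous_on_slice(2)[OF M(1), of 1] M(3)[of 1]
    by (intro exI[of _ "M 1"]) (simp add: F_def half_twist_eq)
qed

lemma half_twist_inj: "half_twist x z = half_twist x w \<longleftrightarrow> z = w"
  by (simp add: half_twist_eq letter_motion_inj)

text \<open>
  Every crossing of the strands \<open>p\<close> and \<open>q\<close> is a half turn, clockwise if it is positive, no matter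
  which strand is the upper one. This is why the angle sees only the sum of the two matrix entries.
\<close>

lemma word_angle_lift:
  "\<exists>L. continuous_on (- {of_nat p}) L \<and>
    (\<forall>z. z \<noteq> of_nat p \<longrightarrow> exp (L z) = (word_homeo w z - word_homeo w (of_nat p)) / (z - of_nat p)) \<and>
    (\<forall>q. q \<noteq> p \<longrightarrow> Im (L (of_nat q)) = - pi * of_int (word_crossing w p q + word_crossing w q p))"
proof (induction w arbitrary: p)
  case Nil
  show ?case by (intro exI[of _ "\<lambda>_. 0"]) auto
next
  case (Cons x w)
  obtain i e where x: "x = (i, e)" by fastforce
  let ?t = "Transposition.transpose i (i + 1)"
  have ht: "half_twist x (of_nat k) = of_nat (?t k)" for k
    unfolding x by (rule half_twist_of_nat)
  obtain L1 where L1: "continuous_on (- {of_nat p}) L1"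
    "\<And>z. z \<noteq> of_nat p \<Longrightarrow> exp (L1 z) = (half_twist x z - of_nat (?t p)) / (z - of_nat p)"
    "\<And>q. q \<noteq> p \<Longrightarrow> Im (L1 (of_nat q)) = - pi * of_int (word_crossing [x] p q + word_crossing [x] q p)"
    using letter_angle_lift[of p x] unfolding ht by blast
  obtain L2 where L2: "continuous_on (- {of_nat (?t p)}) L2"
    "\<And>z. z \<noteq> of_nat (?t p) \<Longrightarrow>
      exp (L2 z) = (word_homeo w z - word_homeo w (of_nat (?t p))) / (z - of_nat (?t p))"
    "\<And>q. q \<noteq> ?t p \<Longrightarrow> Im (L2 (of_nat q)) = - pi * of_int (word_crossing w (?t p) q + word_crossing w q (?t p))"
    using Cons.IH[of "?t p"] by blast
  have ne: "half_twist x z \<noteq> of_nat (?t p)" if "z \<noteq> of_nat p" for z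
    using that half_twist_inj[of x z "of_nat p"] by (simp add: ht)
  have "continuous_on (- {of_nat p}) (\<lambda>z. L1 z + L2 (half_twist x z))"
  proof (intro continuous_on_add L1(1))
    have "continuous_on (- {of_nat p}) (half_twist x)"
      unfolding half_twist_eq letter_motion_def[abs_def] by (intro continuous_intros)
    then show "continuous_on (- {of_nat p}) (\<lambda>z. L2 (half_twist x z))"
      by (rule continuous_on_compose2[OF L2(1)]) (use ne in fastforce)
  qed
  moreover have "exp (L1 z + L2 (half_twist x z))
      = (word_homeo (x # w) z - word_homeo (x # w) (of_nat p)) / (z - of_nat p)" if "z \<noteq> of_nat p" for z
    using L1(2)[OF that] L2(2)[OF ne[OF that]] ne[OF that] by (simp add: exp_add ht)
  moreover have "Im (L1 (of_nat q) + L2 (half_twist x (of_nat q)))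
      = - pi * of_int (word_crossing (x # w) p q + word_crossing (x # w) q p)" if "q \<noteq> p" for q
  proof -
    have "?t q \<noteq> ?t p" using that by (auto simp: Transposition.transpose_def split: if_splits)
    from L2(3)[OF this] L1(3)[OF that] show ?thesis
      unfolding ht by (simp add: x algebra_simps)
  qed
  ultimately show ?case
    by (intro exI[of _ "\<lambda>z. L1 z + L2 (half_twist x z)"]) blast
qed

text \<open>
  The path of a puncture is connected and stays in the finite set of punctures.
\<close>

lemma isotopy_fixes_punctures:
  assumes F: "continuous_on ({0..1::real} \<times> disk n) (\<lambda>(t, z). F t z)"
    "\<And>t. t \<in> {0..1} \<Longrightarrow> disk_homeo n (F t)"
    and k: "k \<in> {1..n}" and t: "t \<in> {0..1}"
  shows "F t (of_nat k) = F 0 (of_nat k)"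
proof -
  have "continuous_on {0..1} (\<lambda>t. F t (of_nat k))"
    by (rule continuous_on_slice(1)[OF F(1) of_nat_in_disk[OF k]])
  then have "connected ((\<lambda>t. F t (of_nat k)) ` {0..1})"
    by (rule connected_continuous_image) simp
  moreover have "(\<lambda>t. F t (of_nat k)) ` {0..1} \<subseteq> punctures n"
  proof (rule image_subsetI)
    fix t :: real assume "t \<in> {0..1}"
    then have "F t ` punctures n = punctures n" using F(2) by (simp add: disk_homeo_iff)
    moreover have "of_nat k \<in> punctures n" using k by (simp add: punctures_def)
    ultimately show "F t (of_nat k) \<in> punctures n" by blast
  qed
  then have "finite ((\<lambda>t. F t (of_nat k)) ` {0..1})"
    by (rule finite_subset) (simp add: punctures_def)
  ultimately obtain a where "(\<lambda>t. F t (of_nat k)) ` {0..1} = {a}"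
    using connected_finite_iff_sing[of "(\<lambda>t. F t (of_nat k)) ` {0..1}"] by auto
  then show ?thesis using t by (metis atLeastAtMost_iff image_eqI order_refl singletonD zero_le_one)
qed

text \<open>
  The lift of the isotopy is constant at a puncture \<open>q\<close>, because the quotient that it lifts is
  constantly \<open>1\<close> there.
\<close>

lemma isotopic_angle_lift:
  assumes fg: "isotopic n f g" and fixed: "\<And>k. k \<in> {1..n} \<Longrightarrow> f (of_nat k) = of_nat k"
    and p: "p \<in> {1..n}"
    and L: "continuous_on (disk n - {of_nat p}) L"
      "\<And>z. z \<in> disk n - {of_nat p} \<Longrightarrow> exp (L z) = (f z - of_nat p) / (z - of_nat p)"
  shows "\<exists>L'. continuous_on (disk n - {of_nat p}) L' \<and>
    (\<forall>z\<in>disk n - {of_nat p}. exp (L' z) = (g z - of_nat p) / (z - of_nat p)) \<and>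
    (\<forall>q\<in>{1..n} - {p}. L' (of_nat q) = L (of_nat q))"
proof -
  let ?U = "disk n - {of_nat p}"
  obtain F where F: "continuous_on ({0..1::real} \<times> disk n) (\<lambda>(t, z). F t z)"
    "\<And>t. t \<in> {0..1} \<Longrightarrow> disk_homeo n (F t)" "F 0 = f" "F 1 = g"
    using isotopicE[OF fg] by blast
  have fixF: "F t (of_nat k) = of_nat k" if "k \<in> {1..n}" "t \<in> {0..1}" for k t
    using isotopy_fixes_punctures[OF F(1,2) that] fixed[OF that(1)] F(3) by simp
  define R where "R t z = (F t z - of_nat p) / (z - of_nat p)" for t z
  have cont: "continuous_on ({0..1} \<times> ?U) (\<lambda>(t, z). R t z)"
  proof -
    have "continuous_on ({0..1} \<times> ?U) (\<lambda>p. F (fst p) (snd p))"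
      using continuous_on_subset[OF F(1), of "{0..1} \<times> ?U"] by (auto simp: case_prod_beta)
    then show ?thesis
      unfolding R_def case_prod_beta by (intro continuous_intros) auto
  qed
  have nz: "R t z \<noteq> 0" if "t \<in> {0..1}" "z \<in> ?U" for t z
  proof -
    have "F t z \<noteq> F t (of_nat p)"
      using F(2)[OF that(1)] disk_auto_inj[of n "F t" z "of_nat p"] that(2) of_nat_in_disk[OF p]
      by (auto simp: disk_homeo_iff)
    then show ?thesis using fixF[OF p that(1)] that(2) by (simp add: R_def)
  qed
  obtain M where M: "continuous_on ({0..1} \<times> ?U) (\<lambda>(t, z). M t z)" "\<And>z. z \<in> ?U \<Longrightarrow> M 0 z = L z"
    "\<And>t z. t \<in> {0..1} \<Longrightarrow> z \<in> ?U \<Longrightarrow> exp (M t z) = R t z"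
    using exp_lift_homotopy[OF cont nz L(1)] L(2) F(3) by (auto simp: R_def)
  have "M 1 (of_nat q) = L (of_nat q)" if q: "q \<in> {1..n} - {p}" for q
  proof -
    have q': "of_nat q \<in> ?U" using q of_nat_in_disk by auto
    have "M 1 (of_nat q) = M 0 (of_nat q)"
    proof (rule exp_lift_unique[of "{0..1::real}" "\<lambda>t. M t (of_nat q)" "\<lambda>t. M 0 (of_nat q)" 0])
      show "exp (M t (of_nat q)) = exp (M 0 (of_nat q))" if "t \<in> {0..1}" for t
        using M(3)[OF that q'] M(3)[OF _ q', of 0] fixF[of q] q that by (simp add: R_def)
    qed (use continuous_on_slice(1)[OF M(1) q'] in auto)
    then show ?thesis using M(2)[OF q'] by simp
  qed
  then show ?thesis
    using continuous_on_slice(2)[OF M(1), of 1] M(3)[of 1] F(4)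
    by (intro exI[of _ "M 1"]) (simp add: R_def)
qed


section \<open>Constant rows for an invariant curve\<close>

lemma disk_homeo_funpow: "disk_homeo n g \<Longrightarrow> disk_homeo n (g ^^ m)"
proof (induction m)
  case 0
  show ?case by (simp add: disk_homeo_iff disk_auto_id cong: disk_auto_cong)
next
  case (Suc m)
  then show ?case using disk_homeo_compose[of n "g ^^ m" g] by (simp add: comp_def)
qed

text \<open>
  The inside of \<open>C\<close> is mapped to itself by \<open>g ^^ k\<close>, simply connected, and misses \<open>i\<close>. Hence the total
  angle \<open>M k z\<close> swept by \<open>z\<close> around \<open>i\<close> under \<open>k\<close> applications of \<open>g\<close> equals, up to a constant, the
  change of a branch \<open>\<alpha>\<close> of the logarithm of \<open>z - i\<close>, and this change is zero at the punctures, which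
  are fixed.
\<close>

lemma invariant_curve_crossing:
  assumes w: "w \<in> braid_words n" "\<And>k. k \<in> {1..n} \<Longrightarrow> end_position w k = k"
    and g: "isotopic n (word_homeo w) g"
    and C: "essential_curve n C" and k: "0 < k" "(g ^^ k) ` C = C"
    and i: "i \<in> {1..n}" "of_nat i \<notin> inside C"
    and j: "j \<in> {1..n}" "of_nat j \<in> inside C" "j' \<in> {1..n}" "of_nat j' \<in> inside C"
  shows "word_crossing w i j = word_crossing w i j'"
proof -
  let ?U = "disk n - {of_nat i}"
  obtain \<gamma> where \<gamma>: "simple_path \<gamma>" "pathfinish \<gamma> = pathstart \<gamma>" "path_image \<gamma> = C"
    and C_sub: "C \<subseteq> disk n - punctures n"
    using C by (auto simp: essential_curve_def)
  have C_disk: "C \<subseteq> disk n" using C_sub by blast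
  have homeo: "disk_homeo n (g ^^ m)" for m
    using isotopic_imp_disk_homeo(2)[OF g] by (rule disk_homeo_funpow)
  then have auto: "disk_auto n (g ^^ m)" for m by (simp add: disk_homeo_iff)
  have fixed: "g (of_nat q) = of_nat q" if "q \<in> {1..n}" for q
  proof -
    obtain F where "continuous_on ({0..1::real} \<times> disk n) (\<lambda>(t, z). F t z)"
      "\<And>t. t \<in> {0..1} \<Longrightarrow> disk_homeo n (F t)" "F 0 = word_homeo w" "F 1 = g"
      using isotopicE[OF g] by blast
    from isotopy_fixes_punctures[OF this(1,2) that, of 1] this(3,4) show ?thesis
      using w(2)[OF that] by (simp add: word_homeo_of_nat)
  qed
  have fix_pow: "(g ^^ m) (of_nat q) = of_nat q" if "q \<in> {1..n}" for q m
    by (induction m) (simp_all add: fixed[OF that])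
  have pow_U: "(g ^^ m) z \<in> ?U" if "z \<in> ?U" for z m
    using that auto[of m] disk_auto_in_disk disk_auto_inj[OF auto[of m], of z "of_nat i"]
      fix_pow[OF i(1), of m] of_nat_in_disk[OF i(1)] by auto
  obtain L0 where L0: "continuous_on (- {of_nat i}) L0"
    "\<And>z. z \<noteq> of_nat i \<Longrightarrow> exp (L0 z) = (word_homeo w z - of_nat i) / (z - of_nat i)"
    "\<And>q. q \<noteq> i \<Longrightarrow> Im (L0 (of_nat q)) = - pi * of_int (word_crossing w i q + word_crossing w q i)"
    using word_angle_lift[of i w] w(2)[OF i(1)] by (auto simp: word_homeo_of_nat)
  obtain L where L: "continuous_on ?U L"
    "\<And>z. z \<in> ?U \<Longrightarrow> exp (L z) = (g z - of_nat i) / (z - of_nat i)"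
    "\<And>q. q \<in> {1..n} - {i} \<Longrightarrow> L (of_nat q) = L0 (of_nat q)"
  proof -
    have "continuous_on ?U L0" using L0(1) by (rule continuous_on_subset) auto
    moreover have "word_homeo w (of_nat q) = of_nat q" if "q \<in> {1..n}" for q
      using w(2)[OF that] by (simp add: word_homeo_of_nat)
    moreover have "exp (L0 z) = (word_homeo w z - of_nat i) / (z - of_nat i)" if "z \<in> ?U" for z
      using L0(2) that by simp
    ultimately show ?thesis
      using isotopic_angle_lift[OF g _ i(1), of L0] that by blast
  qed
  define M where "M m z = (\<Sum>l<m. L ((g ^^ l) z))" for m z
  have M_cont: "continuous_on ?U (M m)" for m
    unfolding M_def
  proof (intro continuous_intros)
    fix l
    have "continuous_on ?U (g ^^ l)"
      using auto[of l] by (auto simp: disk_auto_def intro: continuous_on_subset)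
    then show "continuous_on ?U (\<lambda>z. L ((g ^^ l) z))"
      by (rule continuous_on_compose2[OF L(1)]) (use pow_U in auto)
  qed
  have M_exp: "exp (M m z) = ((g ^^ m) z - of_nat i) / (z - of_nat i)" if "z \<in> ?U" for m z
  proof (induction m)
    case 0
    then show ?case using that by (simp add: M_def)
  next
    case (Suc m)
    have "exp (M (Suc m) z) = exp (M m z) * exp (L ((g ^^ m) z))"
      by (simp add: M_def exp_add)
    with Suc L(2)[OF pow_U[OF that, of m]] pow_U[OF that, of m] show ?case by simp
  qed
  have M_at: "M m (of_nat q) = of_nat m * L (of_nat q)" if "q \<in> {1..n}" for m q
    by (simp add: M_def fix_pow[OF that])
  have inside_U: "inside C \<subseteq> ?U"
    using inside_subset_disk[OF C_disk] i(2) by auto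
  have pow_inside: "(g ^^ k) z \<in> inside C" if "z \<in> inside C" for z
    using inside_disk_auto[OF auto C_disk, of k] k(2) that by auto
  have "simply_connected (inside C)"
    using simply_connected_inside_simple_path[OF \<gamma>(1)] \<gamma>(3) by simp
  moreover have "open (inside C)"
    using Jordan_inside_outside[OF \<gamma>(1,2)] \<gamma>(3) by auto
  ultimately have conn: "connected (inside C)"
    and logs: "\<forall>f :: complex \<Rightarrow> complex. continuous_on (inside C) f \<and> (\<forall>z\<in>inside C. f z \<noteq> 0) \<longrightarrow>
      (\<exists>g. continuous_on (inside C) g \<and> (\<forall>z\<in>inside C. f z = exp (g z)))"
    by (simp_all add: simply_connected_eq_continuous_log)
  have "continuous_on (inside C) (\<lambda>z. z - of_nat i)" by (intro continuous_intros)
  moreover have "\<forall>z\<in>inside C. z - of_nat i \<noteq> 0" using i(2) by auto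
  ultimately have "\<exists>\<alpha>. continuous_on (inside C) \<alpha> \<and> (\<forall>z\<in>inside C. z - of_nat i = exp (\<alpha> z))"
    using logs by blast
  then obtain \<alpha> where \<alpha>: "continuous_on (inside C) \<alpha>" "\<And>z. z \<in> inside C \<Longrightarrow> exp (\<alpha> z) = z - of_nat i"
    by metis
  \<comment> \<open>a continuous logarithm of \<open>1\<close>, hence constant on the connected inside\<close>
  define N where "N z = M k z + \<alpha> z - \<alpha> ((g ^^ k) z)" for z
  have "continuous_on (inside C) (g ^^ k)"
    using auto[of k] inside_U by (auto simp: disk_auto_def intro: continuous_on_subset)
  then have "continuous_on (inside C) (\<lambda>z. \<alpha> ((g ^^ k) z))"
    by (rule continuous_on_compose2[OF \<alpha>(1)]) (use pow_inside in auto)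
  then have N_cont: "continuous_on (inside C) N"
    unfolding N_def using inside_U by (intro continuous_intros \<alpha>(1) continuous_on_subset[OF M_cont])
  have N_exp: "exp (N z) = 1" if "z \<in> inside C" for z
  proof -
    have zU: "z \<in> ?U" and "(g ^^ k) z \<noteq> of_nat i"
      using that pow_inside[OF that] inside_U by auto
    then show ?thesis
      using M_exp[OF zU, of k] \<alpha>(2)[OF that] \<alpha>(2)[OF pow_inside[OF that]]
      by (simp add: N_def exp_add exp_diff)
  qed
  have N_eq: "N (of_nat j) = N (of_nat j')"
    by (rule exp_lift_unique[OF conn N_cont, of "\<lambda>_. N (of_nat j')" "of_nat j'"]) (use N_exp j in auto)
  have "L (of_nat j) = L (of_nat j')"
    using N_eq k(1) M_at fix_pow j(1,3) by (simp add: N_def)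
  moreover have ne: "j \<noteq> i" "j' \<noteq> i" using i(2) j by auto
  ultimately have "L0 (of_nat j) = L0 (of_nat j')"
    using L(3) j by auto
  then have "word_crossing w i j + word_crossing w j i = word_crossing w i j' + word_crossing w j' i"
    using L0(3)[OF ne(1)] L0(3)[OF ne(2)] pi_neq_zero
    by (metis (no_types, lifting) mult_cancel_left neg_equal_0_iff_equal of_int_eq_iff)
  moreover have "word_crossing w j i = word_crossing w i j" "word_crossing w j' i = word_crossing w i j'"
    using w(2) i(1) j by (auto intro: word_crossing_sym)
  ultimately show ?thesis by simp
qed

text \<open>
  The forward orbit of a curve in a finite family runs into a cycle.
\<close>

lemma periodic_curve:
  assumes "\<C> \<noteq> {}" "finite \<C>" "(\<lambda>C. g ` C) ` \<C> = \<C>"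
  shows "\<exists>C\<in>\<C>. \<exists>k>0. (g ^^ k) ` C = C"
proof -
  obtain C0 where C0: "C0 \<in> \<C>" using assms(1) by blast
  have orbit: "(g ^^ m) ` C0 \<in> \<C>" for m
  proof (induction m)
    case (Suc m)
    then have "g ` (g ^^ m) ` C0 \<in> \<C>" using assms(3) by blast
    then show ?case by (simp add: image_comp)
  qed (simp add: C0)
  have "\<not> inj (\<lambda>m. (g ^^ m) ` C0)"
    using orbit assms(2) by (meson finite_subset image_subsetI finite_imageD infinite_UNIV_nat)
  then obtain l m where lm: "(g ^^ l) ` C0 = (g ^^ m) ` C0" "l < m"
    by (metis (mono_tags, lifting) injI linorder_neqE_nat)
  have "(g ^^ (m - l)) ` (g ^^ l) ` C0 = (g ^^ l) ` C0"
  proof -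
    have "(g ^^ (m - l)) ` (g ^^ l) ` C0 = (g ^^ (m - l + l)) ` C0"
      by (simp only: image_comp funpow_add)
    then show ?thesis using lm by simp
  qed
  then show ?thesis using orbit[of l] lm(2) by (intro bexI[OF _ orbit] exI[of _ "m - l"]) auto
qed


section \<open>Partitions with constant blocks\<close>

lemma singleton_blocks_partition:
  assumes "S \<subseteq> {1..n}" "card S \<in> {2..n - 1}"
  defines "P \<equiv> insert S ((\<lambda>i. {i}) ` ({1..n} - S))"
  shows "partition_on {1..n} P" "1 < card P" "card P < n"
proof -
  have fin: "finite S" using assms(1) finite_subset by blast
  have "S \<noteq> {}" using assms(2) by auto
  then show "partition_on {1..n} P"
    using assms(1) by (intro partition_onI) (auto simp: P_def disjnt_def)
  have "S \<notin> (\<lambda>i. {i}) ` ({1..n} - S)" by auto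
  then have "card P = Suc (card ((\<lambda>i. {i}) ` ({1..n} - S)))"
    by (simp add: P_def)
  also have "\<dots> = Suc (n - card S)"
    using assms(1) fin by (simp add: card_image inj_on_def card_Diff_subset)
  finally show "1 < card P" "card P < n" using assms(2) by auto
qed

text \<open>
  Fewer than \<open>n\<close> blocks cannot all be singletons, and no block is everything if there are two.
\<close>

lemma partition_large_block:
  assumes "partition_on {1..n} P" "1 < card P" "card P < n"
  shows "\<exists>K\<in>P. card K \<in> {2..n - 1}"
proof -
  have sub: "K \<subseteq> {1..n}" "K \<noteq> {}" "finite K" if "K \<in> P" for K
    using assms(1) that finite_subset[of K "{1..n}"] by (auto simp: partition_on_def)
  have "finite P" using assms(2) card.infinite by fastforce
  have "\<exists>K\<in>P. 2 \<le> card K"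
  proof (rule ccontr)
    assume "\<not> (\<exists>K\<in>P. 2 \<le> card K)"
    moreover have "card K \<noteq> 0" if "K \<in> P" for K using sub[OF that] by simp
    ultimately have "card K = 1" if "K \<in> P" for K using that by fastforce
    then have "(\<Sum>K\<in>P. card K) = card P" by simp
    moreover have "(\<Sum>K\<in>P. card K) = card {1..n}"
      using card_Union_disjoint[of P] assms(1) sub by (simp add: partition_on_def)
    ultimately show False using assms(3) by simp
  qed
  then obtain K where K: "K \<in> P" "2 \<le> card K" by blast
  have "K \<noteq> {1..n}"
  proof
    assume "K = {1..n}"
    have "L = K" if "L \<in> P" for L
    proof (rule ccontr)
      assume "L \<noteq> K"
      then have "L \<inter> K = {}"
        using assms(1) that K(1) by (auto simp: partition_on_def dest: disjointD)
      then show False using sub(1,2)[OF that] \<open>K = {1..n}\<close> by blast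
    qed
    then have "P \<subseteq> {K}" by blast
    then have "card P \<le> card {K}" by (intro card_mono) auto
    then show False using assms(2) by simp
  qed
  then have "card K < card {1..n}"
    using sub[OF K(1)] by (intro psubset_card_mono) auto
  with K show ?thesis by auto
qed

theorem theorem1:
  fixes n :: nat and A :: "nat \<Rightarrow> nat \<Rightarrow> int"
  assumes "n \<ge> 3"
  shows "(\<exists>b\<in>braid_group n. pure_braid n b \<and> reducible_braid n b \<and>
            (\<forall>i\<in>{1..n}. \<forall>j\<in>{1..n}. A i j = crossing_matrix b i j))
     \<longleftrightarrow> (\<forall>i\<in>{1..n}. A i i = 0) \<and>
         (\<forall>i\<in>{1..n}. \<forall>j\<in>{1..n}. A i j = A j i) \<and>
         (\<exists>P. partition_on {1..n} P \<and> 1 < card P \<and> card P < n \<and>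
            (\<forall>K\<in>P. \<forall>L\<in>P. K \<noteq> L \<longrightarrow>
               (\<forall>(i, j)\<in>K \<times> L. \<forall>(i', j')\<in>K \<times> L. A i j = A i' j')))"
    (is "?braid \<longleftrightarrow> ?diag \<and> ?sym \<and> ?blocks")
proof
  assume ?braid
  then obtain b where b: "b \<in> braid_group n" "pure_braid n b" "reducible_braid n b"
    and A: "\<And>i j. i \<in> {1..n} \<Longrightarrow> j \<in> {1..n} \<Longrightarrow> A i j = crossing_matrix b i j" by blast
  obtain \<C> g where \<C>: "\<C> \<noteq> {}" "finite \<C>" "\<And>C. C \<in> \<C> \<Longrightarrow> essential_curve n C"
    and g: "g \<in> mapping_class n b" "(\<lambda>C. g ` C) ` \<C> = \<C>"
    using b(3) by (auto simp: reducible_braid_def)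
  obtain w where wb: "w \<in> b" and iso: "isotopic n (word_homeo w) g"
    using g(1) by (auto simp: mapping_class_def)
  have "b \<in> braid_words n // braid_rel n" using b(1) by (simp add: braid_group_def)
  then have w: "w \<in> braid_words n"
    using in_quotient_imp_subset[OF equiv_braid_rel] wb by blast
  have pure: "end_position w k = k" if "k \<in> {1..n}" for k
    using b(2) wb that by (auto simp: pure_braid_def)
  have Aw: "A i j = word_crossing w i j" if "i \<in> {1..n}" "j \<in> {1..n}" for i j
    using A[OF that] crossing_matrix_eq[OF b(1) wb] by simp
  have sym: "A i j = A j i" if "i \<in> {1..n}" "j \<in> {1..n}" for i j
    using that word_crossing_sym[OF pure pure] by (simp add: Aw)
  obtain C k where C: "C \<in> \<C>" "0 < k" "(g ^^ k) ` C = C"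
    using periodic_curve[OF \<C>(1,2) g(2)] by blast
  define S where "S = {j \<in> {1..n}. of_nat j \<in> inside C}"
  have "inside C \<inter> punctures n = of_nat ` S"
    by (auto simp: S_def punctures_def)
  then have S: "S \<subseteq> {1..n}" "card S \<in> {2..n - 1}"
    using \<C>(3)[OF C(1)] by (auto simp: essential_curve_def S_def card_image inj_on_def)
  have const: "A i j = A i j'" if "i \<in> {1..n} - S" "j \<in> S" "j' \<in> S" for i j j'
    using that invariant_curve_crossing[OF w pure iso \<C>(3)[OF C(1)] C(2,3), of i j j']
    by (simp add: S_def Aw)
  have "\<forall>K\<in>insert S ((\<lambda>i. {i}) ` ({1..n} - S)). \<forall>L\<in>insert S ((\<lambda>i. {i}) ` ({1..n} - S)). K \<noteq> L \<longrightarrow>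
      (\<forall>(i, j)\<in>K \<times> L. \<forall>(i', j')\<in>K \<times> L. A i j = A i' j')"
  proof (intro ballI impI, clarify)
    fix K L i j i' j'
    assume KL: "K \<in> insert S ((\<lambda>i. {i}) ` ({1..n} - S))" "L \<in> insert S ((\<lambda>i. {i}) ` ({1..n} - S))" "K \<noteq> L"
      and ij: "i \<in> K" "j \<in> L" "i' \<in> K" "j' \<in> L"
    consider "K = S" "L \<in> (\<lambda>i. {i}) ` ({1..n} - S)" | "K \<in> (\<lambda>i. {i}) ` ({1..n} - S)" "L = S"
      | "K \<in> (\<lambda>i. {i}) ` ({1..n} - S)" "L \<in> (\<lambda>i. {i}) ` ({1..n} - S)"
      using KL by blast
    then show "A i j = A i' j'"
    proof cases
      case 1
      then have "j \<in> {1..n} - S" "j' = j" using ij by auto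
      moreover have "i \<in> {1..n}" "i' \<in> {1..n}" "i \<in> S" "i' \<in> S" using 1 ij S(1) by auto
      ultimately show ?thesis using const[of j i i'] sym[of i j] sym[of i' j] by simp
    next
      case 2
      then have "i \<in> {1..n} - S" "i' = i" "j \<in> S" "j' \<in> S" using ij by auto
      then show ?thesis using const[of i j j'] by simp
    next
      case 3
      then have "i' = i" "j' = j" using ij by auto
      then show ?thesis by simp
    qed
  qed
  then have ?blocks
    using singleton_blocks_partition[OF S] by blast
  then show "?diag \<and> ?sym \<and> ?blocks"
    using sym by (auto simp: Aw word_crossing_self)
next
  assume rhs: "?diag \<and> ?sym \<and> ?blocks"
  then obtain P where P: "partition_on {1..n} P" "1 < card P" "card P < n"
    and blocks: "\<And>K L i j i' j'. K \<in> P \<Longrightarrow> L \<in> P \<Longrightarrow> K \<noteq> L \<Longrightarrow> i \<in> K \<Longrightarrow> j \<in> L \<Longrightarrow>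
      i' \<in> K \<Longrightarrow> j' \<in> L \<Longrightarrow> A i j = A i' j'"
    by fast
  obtain S where S: "S \<in> P" "card S \<in> {2..n - 1}"
    using partition_large_block[OF P] by blast
  have S_sub: "S \<subseteq> {1..n}" using P(1) S(1) by (auto simp: partition_on_def)
  have const: "A i j = A i j'" if "i \<in> {1..n} - S" "j \<in> S" "j' \<in> S" for i j j'
  proof -
    obtain K where K: "K \<in> P" "i \<in> K"
      using P(1) \<open>i \<in> {1..n} - S\<close> unfolding partition_on_def by blast
    then have "K \<noteq> S" using that(1) by auto
    then show ?thesis using blocks[OF K(1) S(1)] K(2) that by blast
  qed
  have "\<exists>u\<in>braid_words n. realized n (word_homeo u ` block_circle (card S)) A"
  proof (rule realized_block[OF S_sub refl])
    show "1 \<le> card S" "card S < n" using S(2) by auto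
    show "A i i = 0" if "i \<in> {1..n}" for i using rhs that by blast
    show "A i j = A j i" if "i \<in> {1..n}" "j \<in> {1..n}" for i j using rhs that by blast
  qed (rule const)
  then obtain u where u: "u \<in> braid_words n" "realized n (word_homeo u ` block_circle (card S)) A"
    by blast
  have "essential_curve n (word_homeo u ` block_circle (card S))"
    using S(2)
    by (intro essential_curve_disk_homeo[OF disk_homeo_word_homeo[OF u(1)]] essential_curve_block_circle) auto
  then show ?braid
    using u(2) by (rule reducible_if_realized)
qed

end
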